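(* Let $L$ be the free graded Lie algebra over $\mathbb{Z}$ on a finite set $X$ of homogeneous generators, where the distinct degrees of generators are $1\leq q_1<\dots<q_\ell$ and there are $m_i\geq1$ generators of degree $q_i$. Let $g=\gcd(q_1,\dots,q_\ell)$. Let $\varphi$ be the unique positive real root of $P(z)=z^{q_\ell}-\sum_{i=1}^\ell m_iz^{q_\ell-q_i}$, and let $\psi$ be a root of $P$ of largest absolute value among those with absolute value strictly less than $\varphi$. Then for every positive integer $N$ (where $L_N$ is a free $\mathbb{Z}$-module of finite rank): (i) if $g\nmid N$ then $\mathrm{rank}(L_N)=0$; (ii) if $g\mid N$ then $$\Big|\mathrm{rank}(L_N)-\frac gN\varphi^N\Big|\leq \frac{q_\ell}{N}|\psi|^N+g\varphi^{N/2}+q_\ell|\psi|^{N/2},$$ where, if $P$ has no root of absolute value strictly less than $\varphi$, the terms involving $\psi$ are omitted. Moreover $\varphi\geq\big(\sum_{i=1}^\ell m_i\big)^{1/q_\ell}$.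
   Context: $L_N$ denotes the degree-$N$ part of $L$. *)

theory Defs
  imports "HOL-Analysis.Analysis" "HOL-Computational_Algebra.Polynomial"
begin

text \<open>The free associative ring over Z on an alphabet of type 'a is modelled as
  integer-valued functions on words ('a list); the free Lie ring on X is the
  Lie subring generated by the letters of X (Lie polynomials).\<close>

definition wdeg :: "('a \<Rightarrow> nat) \<Rightarrow> 'a list \<Rightarrow> nat" where
  "wdeg d w = sum_list (map d w)"

definition amul :: "('a list \<Rightarrow> int) \<Rightarrow> ('a list \<Rightarrow> int) \<Rightarrow> ('a list \<Rightarrow> int)" where
  "amul f g = (\<lambda>w. \<Sum>i\<le>length w. f (take i w) * g (drop i w))"

definition lie_br :: "('a list \<Rightarrow> int) \<Rightarrow> ('a list \<Rightarrow> int) \<Rightarrow> ('a list \<Rightarrow> int)" where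
  "lie_br f g = (\<lambda>w. amul f g w - amul g f w)"

definition letter :: "'a \<Rightarrow> ('a list \<Rightarrow> int)" where
  "letter x = (\<lambda>w. if w = [x] then 1 else 0)"

inductive_set free_lie :: "'a set \<Rightarrow> ('a list \<Rightarrow> int) set" for X where
  gen: "x \<in> X \<Longrightarrow> letter x \<in> free_lie X"
| zero: "(\<lambda>_. 0) \<in> free_lie X"
| add: "f \<in> free_lie X \<Longrightarrow> g \<in> free_lie X \<Longrightarrow> (\<lambda>w. f w + g w) \<in> free_lie X"
| neg: "f \<in> free_lie X \<Longrightarrow> (\<lambda>w. - f w) \<in> free_lie X"
| br: "f \<in> free_lie X \<Longrightarrow> g \<in> free_lie X \<Longrightarrow> lie_br f g \<in> free_lie X"

definition lie_comp :: "'a set \<Rightarrow> ('a \<Rightarrow> nat) \<Rightarrow> nat \<Rightarrow> ('a list \<Rightarrow> int) set" where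
  "lie_comp X d N = {f \<in> free_lie X. \<forall>w. f w \<noteq> 0 \<longrightarrow> wdeg d w = N}"

definition int_lin_indep :: "('a list \<Rightarrow> int) set \<Rightarrow> bool" where
  "int_lin_indep S \<longleftrightarrow>
     (\<forall>c. (\<forall>w. (\<Sum>s\<in>S. c s * s w) = 0) \<longrightarrow> (\<forall>s\<in>S. c s = 0))"

definition zrank :: "('a list \<Rightarrow> int) set \<Rightarrow> nat" where
  "zrank M = Sup {card S | S. finite S \<and> S \<subseteq> M \<and> int_lin_indep S}"

definition mult_deg :: "'a set \<Rightarrow> ('a \<Rightarrow> nat) \<Rightarrow> nat \<Rightarrow> nat" where
  "mult_deg X d q = card {x \<in> X. d x = q}"

definition charP :: "'a set \<Rightarrow> ('a \<Rightarrow> nat) \<Rightarrow> complex poly" where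
  "charP X d = monom 1 (Max (d ` X))
     - (\<Sum>q\<in>d ` X. monom (of_nat (mult_deg X d q)) (Max (d ` X) - q))"

end

(*
  Lazard elimination replaces a generator x of least degree k by the elements ad(x)^n y, where y runs
  through the other generators: L is the sum of Z x and the Lie ring generated by these, and the
  enveloping ring is spanned by the products x^i m with m in their enveloping ring.  Iterating up to
  degree N, modulo everything of degree greater than N, yields homogeneous Lie elements h_1, h_2, ...
  of degrees e_1, e_2, ... with prod (1 - t^(e_i)) = 1 - sum_x t^(d x) modulo t^(N+1).  By this
  identity there are as many ordered monomials in the h_i of degree N as words of degree N; since these
  monomials span the words, they are linearly independent, and so the h_i of degree N form a basis
  of L_N.  Logarithmic derivatives turn the identity into
  sum_{n | N} n rank(L_n) = sum of the z^N over the roots z of P.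

  The roots of modulus at least phi are the solutions of z^g = phi^g, all of them simple, which gives
  the main term g phi^N / N and the error term q |psi|^N / N.  The remaining error
  T = sum_{n | N, n < N} (n / N) rank(L_n) satisfies T^2 <= (number of words of degree N) <= phi^N:
  if h_i and h_j both have degree N/k, then h_i^(k-1) h_j is a monomial of degree N, and counting
  these monomials bounds the squares of the ranks.
*)
theory Submission
  imports Defs "HOL-Computational_Algebra.Computational_Algebra"
begin

text \<open>Eliminating even one generator produces infinitely many new ones. Cutting at degree
  \<open>N\<close> keeps every stage a finite list and makes the process stop: the generators of
  least degree are used up one at a time, and all newly created ones have larger degree. The cut is
  harmless because everything is finally projected to degree \<open>N\<close>. Elimination yields
  only spanning statements; independence comes from counting. The words of one degree are visibly
  independent over the integers, and a family that spans them and is no larger than their number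
  admits no relation. Only in degree \<open>N\<close> is the number of h_i identified with a rank.
  For a proper divisor n of \<open>N\<close> the number of h_i of degree n itself enters both the
  divisor identity and the bound on \<open>T\<close>. That bound has constant 1 although h_i h_j is
  an ordered monomial for only about half of the pairs when k = 2: the k-th count enters
  \<open>T\<close> with factor 1/k, and 2/4 + 1/9 + 1/16 + ... is still below 1.\<close>

subsection \<open>Noncommutative power series with integer coefficients\<close>

lemma amul_Nil [simp]: "amul f g [] = f [] * g []"
  by (simp add: amul_def)

text \<open>Separates the cut before the first letter; the other cuts multiply the left derivative
  \<open>\<lambda>v. f (a # v)\<close> by \<open>g\<close>. This recursion carries the inductions on
  words, with \<open>f\<close> generalized because it changes at each letter.\<close>

lemma amul_Cons: "amul f g (a # w) = f [] * g (a # w) + amul (\<lambda>v. f (a # v)) g w"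
  unfolding amul_def by (simp add: sum.atMost_Suc_shift del: sum.atMost_Suc)

lemma amul_add_left: "amul (\<lambda>w. f w + g w) h w = amul f h w + amul g h w"
  by (simp add: amul_def sum.distrib algebra_simps)

lemma amul_add_right: "amul h (\<lambda>w. f w + g w) w = amul h f w + amul h g w"
  by (simp add: amul_def sum.distrib algebra_simps)

lemma amul_scale_left: "amul (\<lambda>w. c * f w) h w = c * amul f h w"
  by (simp add: amul_def sum_distrib_left algebra_simps)

lemma amul_assoc: "amul (amul f g) h w = amul f (amul g h) w"
proof (induction w arbitrary: f)
  case (Cons a w)
  have "(\<lambda>v. amul f g (a # v)) = (\<lambda>v. f [] * g (a # v) + amul (\<lambda>v. f (a # v)) g v)"
    by (simp add: amul_Cons)
  then show ?case
    by (simp add: amul_Cons amul_add_left amul_scale_left Cons.IH algebra_simps)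
qed simp

lemma amul_one_left: "amul (\<lambda>w. if w = [] then 1 else 0) f w = f w"
proof (cases w)
  case (Cons a v)
  have "amul (\<lambda>v. if a # v = [] then 1 else 0) f v = 0" for v
    by (simp add: amul_def)
  then show ?thesis using Cons by (simp add: amul_Cons)
qed simp

lemma amul_one_right: "amul f (\<lambda>w. if w = [] then 1 else 0) w = f w"
  by (induction w arbitrary: f) (simp_all add: amul_Cons)

text \<open>A type of its own allows a \<open>ring_1\<close> instance with the concatenation
  product. No finite support is required: a word has only finitely many cuts, so products make sense
  for all functions.\<close>

typedef 'a nc_series = "UNIV :: ('a list \<Rightarrow> int) set"
  morphisms nc_coeff Nc_series by simp

lemmas nc_coeff_Nc_series [simp] = Nc_series_inverse[OF UNIV_I]

lemma nc_series_eqI: "(\<And>w. nc_coeff f w = nc_coeff g w) \<Longrightarrow> f = g"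
  by (metis ext nc_coeff_inject)

instantiation nc_series :: (type) ring_1
begin

definition "0 = Nc_series (\<lambda>_. 0)"
definition "1 = Nc_series (\<lambda>w. if w = [] then 1 else 0)"
definition "f + g = Nc_series (\<lambda>w. nc_coeff f w + nc_coeff g w)"
definition "f - g = Nc_series (\<lambda>w. nc_coeff f w - nc_coeff g w)"
definition "- f = Nc_series (\<lambda>w. - nc_coeff f w)"
definition "f * g = Nc_series (amul (nc_coeff f) (nc_coeff g))"

instance
proof
  fix a b c :: "'a nc_series"
  show "(0::'a nc_series) \<noteq> 1"
    by (auto simp: zero_nc_series_def one_nc_series_def Nc_series_inject fun_eq_iff)
qed (auto intro!: nc_series_eqI simp: zero_nc_series_def one_nc_series_def plus_nc_series_def
      minus_nc_series_def uminus_nc_series_def times_nc_series_def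
      amul_assoc amul_one_left amul_one_right amul_add_left amul_add_right)

end

lemma nc_coeff_0 [simp]: "nc_coeff 0 w = 0"
  and nc_coeff_1: "nc_coeff 1 w = (if w = [] then 1 else 0)"
  and nc_coeff_add [simp]: "nc_coeff (f + g) w = nc_coeff f w + nc_coeff g w"
  and nc_coeff_diff [simp]: "nc_coeff (f - g) w = nc_coeff f w - nc_coeff g w"
  and nc_coeff_uminus [simp]: "nc_coeff (- f) w = - nc_coeff f w"
  and nc_coeff_mult: "nc_coeff (f * g) = amul (nc_coeff f) (nc_coeff g)"
  by (simp_all add: zero_nc_series_def one_nc_series_def plus_nc_series_def
      minus_nc_series_def uminus_nc_series_def times_nc_series_def)

lemma nc_coeff_sum [simp]: "nc_coeff (sum f A) w = (\<Sum>i\<in>A. nc_coeff (f i) w)"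
  by (induction A rule: infinite_finite_induct) auto

lemma nc_coeff_of_int_mult: "nc_coeff (of_int c * f) w = c * nc_coeff f w"
proof -
  have nat: "nc_coeff (of_nat n * f) w = int n * nc_coeff f w" for n
    by (induction n) (auto simp: algebra_simps)
  show ?thesis
    by (cases c) (use nat in \<open>auto simp: algebra_simps simp del: of_nat_Suc\<close>)
qed

subsection \<open>Generated subgroups, subrings and Lie subrings\<close>

text \<open>Adding or subtracting one generator per step avoids integer scalars, so any additive map
  can be followed through the induction.\<close>

inductive_set zspan :: "'r::ring_1 set \<Rightarrow> 'r set" for S where
  zspan_0: "0 \<in> zspan S"
| zspan_add_base: "v \<in> zspan S \<Longrightarrow> s \<in> S \<Longrightarrow> v + s \<in> zspan S"
| zspan_diff_base: "v \<in> zspan S \<Longrightarrow> s \<in> S \<Longrightarrow> v - s \<in> zspan S"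

lemma zspan_base: "s \<in> S \<Longrightarrow> s \<in> zspan S"
  using zspan_add_base[OF zspan_0] by fastforce

lemma zspan_add:
  assumes "v \<in> zspan S" "u \<in> zspan S"
  shows "u + v \<in> zspan S"
  using assms(1)
proof induction
  case zspan_0
  then show ?case using assms by simp
next
  case (zspan_add_base v s)
  then show ?case using zspan.zspan_add_base[of "u + v" S s] by (simp add: algebra_simps)
next
  case (zspan_diff_base v s)
  then show ?case using zspan.zspan_diff_base[of "u + v" S s] by (simp add: algebra_simps)
qed

lemma zspan_minus:
  assumes "v \<in> zspan S"
  shows "- v \<in> zspan S"
  using assms
proof induction
  case zspan_0
  then show ?case using zspan.zspan_0 by simp
next
  case (zspan_add_base v s)
  then show ?case using zspan.zspan_diff_base[of "- v" S s] by simp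
next
  case (zspan_diff_base v s)
  then show ?case using zspan.zspan_add_base[of "- v" S s] by simp
qed

lemma zspan_diff: "v \<in> zspan S \<Longrightarrow> u \<in> zspan S \<Longrightarrow> u - v \<in> zspan S"
  using zspan_add[OF zspan_minus] by fastforce

lemma zspan_additive_image:
  fixes f :: "'r::ring_1 \<Rightarrow> 's::ring_1"
  assumes v: "v \<in> zspan S" and add: "\<And>x y. f (x + y) = f x + f y"
    and S: "\<And>s. s \<in> S \<Longrightarrow> f s \<in> zspan T"
  shows "f v \<in> zspan T"
proof -
  have 0: "f 0 = 0" using add[of 0 0] by simp
  have diff: "f (x - y) = f x - f y" for x y
    using add[of "x - y" y] by simp
  show ?thesis using v
    by induction (auto simp: 0 diff add intro: zspan.zspan_0 zspan_add zspan_diff S)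
qed

lemma zspan_subset_zspan:
  assumes "v \<in> zspan S" "\<And>s. s \<in> S \<Longrightarrow> s \<in> zspan T"
  shows "v \<in> zspan T"
  using zspan_additive_image[of v S "\<lambda>x. x" T] assms by auto

text \<open>The coefficients belong to indices rather than to values, since distinct exponent
  vectors are not known beforehand to give distinct monomials.\<close>

lemma zspan_image_sum:
  assumes "v \<in> zspan (f ` J)" "finite J"
  shows "\<exists>c. v = (\<Sum>j\<in>J. of_int (c j) * f j)"
  using assms(1)
proof induction
  case zspan_0
  show ?case by (intro exI[of _ "\<lambda>_. 0"]) simp
next
  case (zspan_add_base v s)
  then obtain c j where c: "v = (\<Sum>j\<in>J. of_int (c j) * f j)" "s = f j" "j \<in> J" by auto
  have "v + s = (\<Sum>i\<in>J. of_int (c i) * f i) + (\<Sum>i\<in>J. if i = j then f j else 0)"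
    using c assms(2) by simp
  also have "\<dots> = (\<Sum>i\<in>J. of_int ((\<lambda>i. c i + (if i = j then 1 else 0)) i) * f i)"
    unfolding sum.distrib[symmetric] by (intro sum.cong) (auto simp: algebra_simps)
  finally show ?case
    by (intro exI[of _ "\<lambda>i. c i + (if i = j then 1 else 0)"])
next
  case (zspan_diff_base v s)
  then obtain c j where c: "v = (\<Sum>j\<in>J. of_int (c j) * f j)" "s = f j" "j \<in> J" by auto
  have "v - s = (\<Sum>i\<in>J. of_int (c i) * f i) - (\<Sum>i\<in>J. if i = j then f j else 0)"
    using c assms(2) by simp
  also have "\<dots> = (\<Sum>i\<in>J. of_int ((\<lambda>i. c i - (if i = j then 1 else 0)) i) * f i)"
    unfolding sum_subtractf[symmetric] by (intro sum.cong) (auto simp: algebra_simps)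
  finally show ?case
    by (intro exI[of _ "\<lambda>i. c i - (if i = j then 1 else 0)"])
qed

definition bracket :: "'r::ring_1 \<Rightarrow> 'r \<Rightarrow> 'r" where
  "bracket x y = x * y - y * x"

inductive_set lie_gen :: "'r::ring_1 set \<Rightarrow> 'r set" for G where
  lie_gen_base: "x \<in> G \<Longrightarrow> x \<in> lie_gen G"
| lie_gen_0: "0 \<in> lie_gen G"
| lie_gen_add: "x \<in> lie_gen G \<Longrightarrow> y \<in> lie_gen G \<Longrightarrow> x + y \<in> lie_gen G"
| lie_gen_minus: "x \<in> lie_gen G \<Longrightarrow> - x \<in> lie_gen G"
| lie_gen_bracket: "x \<in> lie_gen G \<Longrightarrow> y \<in> lie_gen G \<Longrightarrow> bracket x y \<in> lie_gen G"

inductive_set ring_gen :: "'r::ring_1 set \<Rightarrow> 'r set" for G where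
  ring_gen_base: "x \<in> G \<Longrightarrow> x \<in> ring_gen G"
| ring_gen_0: "0 \<in> ring_gen G"
| ring_gen_1: "1 \<in> ring_gen G"
| ring_gen_add: "x \<in> ring_gen G \<Longrightarrow> y \<in> ring_gen G \<Longrightarrow> x + y \<in> ring_gen G"
| ring_gen_minus: "x \<in> ring_gen G \<Longrightarrow> - x \<in> ring_gen G"
| ring_gen_mult: "x \<in> ring_gen G \<Longrightarrow> y \<in> ring_gen G \<Longrightarrow> x * y \<in> ring_gen G"

lemma lie_gen_subset_lie_gen:
  assumes "v \<in> lie_gen S" "\<And>s. s \<in> S \<Longrightarrow> s \<in> lie_gen T"
  shows "v \<in> lie_gen T"
  using assms by (induction) (auto intro: lie_gen.intros)

text \<open>By the Jacobi identity \<open>bracket x\<close> is a derivation of the Lie bracket, so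
  stability need only be checked on generators.\<close>

lemma bracket_lie_gen_closed:
  assumes G: "\<And>y. y \<in> G \<Longrightarrow> bracket x y \<in> lie_gen G" and y: "y \<in> lie_gen G"
  shows "bracket x y \<in> lie_gen G"
  using y
proof induction
  case (lie_gen_bracket y z)
  have "bracket x (bracket y z) = bracket (bracket x y) z + bracket y (bracket x z)"
    by (simp add: bracket_def algebra_simps)
  with lie_gen_bracket show ?case by (auto intro: lie_gen.intros)
next
  case (lie_gen_add y z)
  have "bracket x (y + z) = bracket x y + bracket x z"
    by (simp add: bracket_def algebra_simps)
  with lie_gen_add show ?case by (auto intro: lie_gen.intros)
next
  case (lie_gen_minus y)
  have "bracket x (- y) = - bracket x y"
    by (simp add: bracket_def algebra_simps)
  with lie_gen_minus show ?case by (auto intro: lie_gen.intros)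
next
  case lie_gen_0
  show ?case by (auto intro: lie_gen.intros simp: bracket_def)
qed (fact G)

text \<open>The same argument for the associative product, of which \<open>bracket x\<close> is also
  a derivation.\<close>

lemma bracket_ring_gen_closed:
  assumes G: "\<And>y. y \<in> G \<Longrightarrow> bracket x y \<in> ring_gen G" and y: "y \<in> ring_gen G"
  shows "bracket x y \<in> ring_gen G"
  using y
proof induction
  case (ring_gen_mult y z)
  have "bracket x (y * z) = bracket x y * z + y * bracket x z"
    by (simp add: bracket_def algebra_simps)
  with ring_gen_mult show ?case by (auto intro: ring_gen.intros)
next
  case (ring_gen_add y z)
  have "bracket x (y + z) = bracket x y + bracket x z"
    by (simp add: bracket_def algebra_simps)
  with ring_gen_add show ?case by (auto intro: ring_gen.intros)
next
  case (ring_gen_minus y)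
  have "bracket x (- y) = - bracket x y"
    by (simp add: bracket_def algebra_simps)
  with ring_gen_minus show ?case by (auto intro: ring_gen.intros)
next
  case ring_gen_0
  show ?case by (auto intro: ring_gen.intros simp: bracket_def)
next
  case ring_gen_1
  show ?case by (auto intro: ring_gen.intros simp: bracket_def)
qed (fact G)

text \<open>The sum of the multiples of \<open>x\<close> and \<open>lie_gen G'\<close> is closed
  under brackets: \<open>bracket x x\<close> vanishes and \<open>bracket x\<close> preserves
  \<open>lie_gen G'\<close>, so a bracket of two elements has no \<open>x\<close>-part at
  all.\<close>

lemma lie_gen_eliminate:
  assumes G': "\<And>y. y \<in> G' \<Longrightarrow> bracket x y \<in> lie_gen G'"
    and G: "G \<subseteq> insert x G'" and v: "v \<in> lie_gen G"
  shows "v \<in> zspan (insert x (lie_gen G'))"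
proof -
  let ?S = "insert x (lie_gen G')"
  note ad = bracket_lie_gen_closed[OF G']
  have decomp: "\<exists>n l. l \<in> lie_gen G' \<and> u = of_int n * x + l" if "u \<in> lie_gen G" for u
    using that
  proof induction
    case (lie_gen_base y)
    then consider "y = x" | "y \<in> G'" using G by auto
    then show ?case
    proof cases
      case 1
      then show ?thesis by (intro exI[of _ 1] exI[of _ 0]) (auto intro: lie_gen.intros)
    next
      case 2
      then show ?thesis by (intro exI[of _ 0] exI[of _ y]) (auto intro: lie_gen.intros)
    qed
  next
    case lie_gen_0
    show ?case by (intro exI[of _ 0] exI[of _ 0]) (auto intro: lie_gen.intros)
  next
    case (lie_gen_add u1 u2)
    then obtain n1 l1 n2 l2 where *: "l1 \<in> lie_gen G'" "u1 = of_int n1 * x + l1"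
      "l2 \<in> lie_gen G'" "u2 = of_int n2 * x + l2" by blast
    then show ?case
      by (intro exI[of _ "n1 + n2"] exI[of _ "l1 + l2"])
         (auto intro: lie_gen.intros simp: algebra_simps)
  next
    case (lie_gen_minus u1)
    then obtain n1 l1 where *: "l1 \<in> lie_gen G'" "u1 = of_int n1 * x + l1" by blast
    then show ?case
      by (intro exI[of _ "- n1"] exI[of _ "- l1"]) (auto intro: lie_gen.intros)
  next
    case (lie_gen_bracket u1 u2)
    then obtain n1 l1 n2 l2 where *: "l1 \<in> lie_gen G'" "u1 = of_int n1 * x + l1"
      "l2 \<in> lie_gen G'" "u2 = of_int n2 * x + l2" by blast
    have scale: "of_int n * l \<in> lie_gen G'" if "l \<in> lie_gen G'" for n l
    proof -
      have nat: "of_nat n * l \<in> lie_gen G'" for n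
        by (induction n) (auto simp: algebra_simps intro: that lie_gen.intros)
      show ?thesis
        by (cases n) (use nat lie_gen_minus[OF nat] in \<open>auto simp del: of_nat_Suc\<close>)
    qed
    have comm: "of_int n * z = z * of_int n" for n :: int and z :: 'a
      by (rule mult_of_int_commute)
    have xx: "(of_int n1 * x) * (of_int n2 * x) = (of_int n2 * x) * (of_int n1 * x)"
      by (metis (no_types, lifting) comm mult.assoc)
    have xl: "bracket (of_int n * x) l = of_int n * bracket x l" for n l
      by (simp add: bracket_def algebra_simps) (metis comm mult.assoc)
    have "bracket u1 u2 = of_int n1 * bracket x l2 + - (of_int n2 * bracket x l1) + bracket l1 l2"
      using xx by (simp add: * flip: xl) (simp add: bracket_def algebra_simps)
    also have "\<dots> \<in> lie_gen G'"
      using * by (intro lie_gen.lie_gen_add lie_gen.lie_gen_minus lie_gen.lie_gen_bracket scale ad) auto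
    finally show ?case by (intro exI[of _ 0] exI[of _ "bracket u1 u2"]) auto
  qed
  obtain n l where nl: "l \<in> lie_gen G'" "v = of_int n * x + l" using decomp v by blast
  have nat: "of_nat n * x \<in> zspan ?S" for n
    by (induction n) (auto simp: algebra_simps intro: zspan_0 zspan_add zspan_base)
  have "of_int n * x \<in> zspan ?S"
    by (cases n) (use nat zspan_minus[OF nat] in \<open>auto simp del: of_nat_Suc\<close>)
  then show ?thesis using nl by (auto intro: zspan_add zspan_base)
qed

text \<open>The rule \<open>r * x = x * r - bracket x r\<close> moves every \<open>x\<close> to the
  left while the correction stays in \<open>ring_gen G'\<close>.\<close>

lemma ring_gen_eliminate:
  assumes G': "\<And>y. y \<in> G' \<Longrightarrow> bracket x y \<in> ring_gen G'"
    and G: "G \<subseteq> insert x G'" and v: "v \<in> ring_gen G"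
  shows "v \<in> zspan {x ^ i * m | i m. m \<in> ring_gen G'}"
proof -
  let ?S = "{x ^ i * m | i m. m \<in> ring_gen G'}"
  note ad = bracket_ring_gen_closed[OF G']
  have x: "x * u \<in> zspan ?S" if "u \<in> zspan ?S" for u
  proof (rule zspan_additive_image[OF that])
    fix s assume "s \<in> ?S"
    then obtain i m where "s = x ^ i * m" "m \<in> ring_gen G'" by auto
    then have "x * s = x ^ Suc i * m" "m \<in> ring_gen G'" by (auto simp: mult.assoc)
    then show "x * s \<in> zspan ?S" by (blast intro: zspan_base)
  qed (simp add: algebra_simps)
  have swap: "r * (x ^ i * m) \<in> zspan ?S" if "r \<in> ring_gen G'" "m \<in> ring_gen G'" for r m i
    using that
  proof (induction i arbitrary: r)
    case 0
    then have "r * (x ^ 0 * m) = x ^ 0 * (r * m)" "r * m \<in> ring_gen G'"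
      by (auto intro: ring_gen.intros)
    then show ?case by (blast intro: zspan_base)
  next
    case (Suc i)
    have "r * (x ^ Suc i * m) = x * (r * (x ^ i * m)) - bracket x r * (x ^ i * m)"
      by (simp add: bracket_def algebra_simps)
    then show ?case using Suc ad by (auto intro!: zspan_diff x)
  qed
  have swap': "r * u \<in> zspan ?S" if "u \<in> zspan ?S" "r \<in> ring_gen G'" for r u
    by (rule zspan_additive_image[OF that(1)]) (auto simp: algebra_simps intro: swap that)
  \<comment> \<open>The span is stable under left multiplication by \<open>ring_gen G\<close>; as it
    contains 1, it contains \<open>v\<close>.\<close>
  have left: "u * s \<in> zspan ?S" if "u \<in> ring_gen G" "s \<in> zspan ?S" for u s
    using that
  proof (induction arbitrary: s)
    case (ring_gen_base y)
    then show ?case using G by (auto intro: x swap' ring_gen.intros)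
  qed (auto simp: algebra_simps intro: zspan_0 zspan_add zspan_minus)
  have "1 = x ^ 0 * 1" by simp
  then have "1 \<in> ?S" by (blast intro: ring_gen.intros)
  then show ?thesis using left[OF v zspan_base[of 1]] by simp
qed

subsection \<open>Lazard elimination\<close>

definition pbw_monomial :: "'r::ring_1 list \<Rightarrow> nat list \<Rightarrow> 'r" where
  "pbw_monomial hs es = prod_list (map2 (^) hs es)"

lemma pbw_monomial_Nil [simp]: "pbw_monomial [] es = 1"
  and pbw_monomial_Cons [simp]: "pbw_monomial (h # hs) (e # es) = h ^ e * pbw_monomial hs es"
  by (simp_all add: pbw_monomial_def)

text \<open>Lists rather than sets, because multiplicities count in the generating function.
  Iterates beyond \<open>N\<close> have degree above \<open>N\<close> when \<open>k\<close> is
  positive and are left to the ideal.\<close>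

definition eliminate :: "nat \<Rightarrow> 'r::ring_1 \<Rightarrow> nat \<Rightarrow> ('r \<times> nat) list \<Rightarrow> ('r \<times> nat) list" where
  "eliminate N x k G =
     concat (map (\<lambda>(y, e). map (\<lambda>n. ((bracket x ^^ n) y, e + n * k)) [0..<Suc N]) G)"

lemma set_eliminate:
  "set (eliminate N x k G) = {((bracket x ^^ n) y, e + n * k) | n y e. n \<le> N \<and> (y, e) \<in> set G}"
  unfolding eliminate_def by (auto simp del: upt_Suc) force+

text \<open>Each bracket with \<open>x\<close> raises the degree by \<open>k\<close>, so only the
  zeroth iterate of a generator can have degree \<open>k\<close>. Hence removing \<open>x\<close>
  and eliminating lowers the number of generators of degree \<open>k\<close> by one.\<close>

lemma filter_eliminate_min_degree:
  assumes "k \<ge> 1" "\<forall>(y, e)\<in>set G. e \<ge> k"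
  shows "filter (\<lambda>(y, e). e = k) (eliminate N x k G) = filter (\<lambda>(y, e). e = k) G"
  using assms(2)
proof (induction G)
  case (Cons p G)
  obtain y e where p: "p = (y, e)" by (cases p)
  have upt: "[0..<Suc N] = 0 # [1..<Suc N]"
    by (simp add: upt_conv_Cons del: upt_Suc)
  have "filter (\<lambda>(y, e). e = k)
      (map (\<lambda>n. ((bracket x ^^ n) y, e + n * k)) [1..<Suc N]) = []"
  proof -
    have "e + n * k \<noteq> k" if "n \<ge> 1" for n
    proof -
      have "k \<le> n * k" "e \<ge> k" using that Cons.prems p by auto
      then show ?thesis using assms(1) by linarith
    qed
    then show ?thesis by (auto simp: filter_empty_conv simp del: upt_Suc)
  qed
  then have "filter (\<lambda>(y, e). e = k)
      (map (\<lambda>n. ((bracket x ^^ n) y, e + n * k)) [0..<Suc N]) = filter (\<lambda>(y, e). e = k) [p]"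
    using assms(1) unfolding upt by (simp add: p del: upt_Suc)
  moreover have "eliminate N x k (p # G) =
      map (\<lambda>n. ((bracket x ^^ n) y, e + n * k)) [0..<Suc N] @ eliminate N x k G"
    by (simp add: eliminate_def p)
  ultimately show ?case using Cons by (simp add: p del: upt_Suc)
qed (simp add: eliminate_def)

definition degree_gf :: "('r \<times> nat) list \<Rightarrow> complex fps" where
  "degree_gf G = (\<Sum>(y, e)\<leftarrow>G. fps_X ^ e)"

lemma degree_gf_simps [simp]:
  "degree_gf [] = 0"
  "degree_gf ((y, e) # G) = fps_X ^ e + degree_gf G"
  "degree_gf (G1 @ G2) = degree_gf G1 + degree_gf G2"
  by (simp_all add: degree_gf_def)

text \<open>A finite geometric sum. The factor \<open>1 - fps_X ^ (Suc N * k)\<close> is the trace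
  of the truncation and is congruent to 1 modulo \<open>fps_X ^ Suc N\<close> for positive
  \<open>k\<close>.\<close>

lemma degree_gf_eliminate:
  "(1 - fps_X ^ k) * degree_gf (eliminate N x k G) = (1 - fps_X ^ (Suc N * k)) * degree_gf G"
proof (induction G)
  case (Cons p G)
  obtain y e where p: "p = (y, e)" by (cases p)
  have "degree_gf (map (\<lambda>n. ((bracket x ^^ n) y, e + n * k)) [0..<Suc N]) =
      (\<Sum>n<Suc N. fps_X ^ (e + n * k))"
    by (simp add: degree_gf_def o_def interv_sum_list_conv_sum_set_nat atLeast0LessThan
        del: upt_Suc sum.lessThan_Suc)
  also have "\<dots> = fps_X ^ e * (\<Sum>n<Suc N. (fps_X ^ k) ^ n)"
    by (simp add: sum_distrib_left power_add power_mult[symmetric] mult.commute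
        del: sum.lessThan_Suc)
  finally have "(1 - fps_X ^ k) *
      degree_gf (map (\<lambda>n. ((bracket x ^^ n) y, e + n * k)) [0..<Suc N]) =
      fps_X ^ e * (1 - (fps_X ^ k) ^ Suc N)"
    unfolding one_diff_power_eq by (simp only: mult_ac)
  also have "\<dots> = (1 - fps_X ^ (Suc N * k)) * fps_X ^ e"
    by (simp only: power_mult[symmetric] mult.commute)
  moreover have "eliminate N x k (p # G) =
      map (\<lambda>n. ((bracket x ^^ n) y, e + n * k)) [0..<Suc N] @ eliminate N x k G"
    by (simp add: eliminate_def p)
  ultimately show ?case using Cons
    by (simp add: p distrib_left del: upt_Suc mult_Suc)
qed (simp add: eliminate_def)

section \<open>Iterated elimination in a graded ring modulo an ideal of high degree\<close>

locale graded_ring_mod_ideal =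
  fixes H :: "nat \<Rightarrow> 'r::ring_1 set" and I :: "'r set" and N :: nat
  assumes H_mult: "x \<in> H m \<Longrightarrow> y \<in> H n \<Longrightarrow> x * y \<in> H (m + n)"
    and H_diff: "x \<in> H n \<Longrightarrow> y \<in> H n \<Longrightarrow> x - y \<in> H n"
    and H_subset_I: "n > N \<Longrightarrow> H n \<subseteq> I"
    and I_0: "0 \<in> I"
    and I_diff: "x \<in> I \<Longrightarrow> y \<in> I \<Longrightarrow> x - y \<in> I"
    and I_mult_left: "y \<in> I \<Longrightarrow> x * y \<in> I"
    and I_mult_right: "x \<in> I \<Longrightarrow> x * y \<in> I"
begin

lemma I_minus: "x \<in> I \<Longrightarrow> - x \<in> I"
  using I_diff[OF I_0] by force

lemma I_add: "x \<in> I \<Longrightarrow> y \<in> I \<Longrightarrow> x + y \<in> I"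
  using I_diff[OF _ I_minus] by fastforce

lemma bracket_I: "y \<in> I \<Longrightarrow> bracket x y \<in> I"
  unfolding bracket_def by (intro I_diff I_mult_left I_mult_right)

lemma H_bracket:
  assumes "x \<in> H m" "y \<in> H n"
  shows "bracket x y \<in> H (m + n)"
  using H_diff[OF H_mult[OF assms]] H_mult[OF assms(2,1)]
  by (simp add: bracket_def add.commute)

lemma H_funpow_bracket:
  assumes "x \<in> H k" "y \<in> H e"
  shows "(bracket x ^^ n) y \<in> H (e + n * k)"
proof (induction n)
  case (Suc n)
  from H_bracket[OF assms(1) Suc] show ?case by (simp add: algebra_simps)
qed (use assms in simp)

lemma lie_gen_I: "v \<in> lie_gen I \<Longrightarrow> v \<in> I"
  by (induction rule: lie_gen.induct) (auto intro: I_0 I_add I_minus bracket_I)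

text \<open>The integers together with \<open>I\<close> already form a subring.\<close>

lemma ring_gen_I:
  assumes "v \<in> ring_gen I"
  shows "v \<in> zspan (insert 1 I)"
proof -
  have "\<exists>n. v - of_int n \<in> I" using assms
  proof induction
    case (ring_gen_base x)
    then show ?case by (intro exI[of _ 0]) simp
  next
    case ring_gen_0
    show ?case by (intro exI[of _ 0]) (simp add: I_0)
  next
    case ring_gen_1
    show ?case by (intro exI[of _ 1]) (simp add: I_0)
  next
    case (ring_gen_add x y)
    then obtain n m where "x - of_int n \<in> I" "y - of_int m \<in> I" by blast
    from I_add[OF this] show ?case by (intro exI[of _ "n + m"]) (simp add: algebra_simps)
  next
    case (ring_gen_minus x)
    then obtain n where "x - of_int n \<in> I" by blast
    from I_minus[OF this] show ?case by (intro exI[of _ "- n"]) (simp add: algebra_simps)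
  next
    case (ring_gen_mult x y)
    then obtain n m where nm: "x - of_int n \<in> I" "y - of_int m \<in> I" by blast
    have "(x - of_int n) * y + of_int n * (y - of_int m) \<in> I"
      by (intro I_add I_mult_left I_mult_right nm)
    moreover have "(x - of_int n) * y + of_int n * (y - of_int m) = x * y - of_int (n * m)"
      by (simp only: of_int_mult) (simp add: algebra_simps)
    ultimately show ?case by metis
  qed
  then obtain n where n: "v - of_int n \<in> I" ..
  have nat: "of_nat k \<in> zspan (insert 1 I)" for k
    by (induction k) (auto intro: zspan_0 zspan_add zspan_base)
  have "of_int n \<in> zspan (insert 1 I)"
    by (cases n) (use nat zspan_minus[OF nat] in \<open>auto simp del: of_nat_Suc\<close>)
  from zspan_add[OF this zspan_base[of "v - of_int n"]] n show ?thesis by simp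
qed

text \<open>The list \<open>G\<close> of generators pairs each element with its degree; working modulo \<open>I\<close>, which
  contains everything of degree above \<open>N\<close>, finitely many generators suffice at each stage.\<close>

definition pbw_basis :: "('r \<times> nat) list \<Rightarrow> ('r \<times> nat) list \<Rightarrow> bool" where
  "pbw_basis G hs \<longleftrightarrow>
     (\<forall>(h, e)\<in>set hs. h \<in> H e \<and> e \<ge> 1 \<and> h \<in> lie_gen (fst ` set G)) \<and>
     lie_gen (fst ` set G \<union> I) \<subseteq> zspan (fst ` set hs \<union> I) \<and>
     ring_gen (fst ` set G \<union> I) \<subseteq>
       zspan ({pbw_monomial (map fst hs) es | es. length es = length hs} \<union> I) \<and>
     fps_X ^ Suc N dvd (\<Prod>(h, e)\<leftarrow>hs. 1 - fps_X ^ e) - (1 - degree_gf G)"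

text \<open>The end of the elimination: all generators lie in \<open>I\<close>, and the empty
  monomial 1 spans the ring they generate modulo \<open>I\<close>.\<close>

lemma pbw_basis_high_degree:
  assumes "\<forall>(y, e)\<in>set G. y \<in> H e \<and> e > N"
  shows "pbw_basis G []"
proof -
  have G: "fst ` set G \<union> I = I" using assms H_subset_I by fastforce
  have "fps_X ^ Suc N dvd degree_gf G" using assms
  proof (induction G)
    case (Cons p G)
    then obtain y e where p: "p = (y, e)" "Suc N \<le> e" by (cases p) auto
    then have "fps_X ^ Suc N dvd (fps_X ^ e :: complex fps)" by (intro le_imp_power_dvd)
    with Cons p show ?case by (simp del: power_Suc)
  qed simp
  then show ?thesis unfolding pbw_basis_def G
    using lie_gen_I ring_gen_I by (auto intro: zspan_base simp del: power_Suc)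
qed

text \<open>The eliminated \<open>x\<close> is put at the head of the list because
  \<open>ring_gen_eliminate\<close> places its powers leftmost.\<close>

lemma pbw_basis_eliminate:
  assumes x: "x \<in> H k" and k: "k \<ge> 1" and G: "\<forall>(y, e)\<in>set (G1 @ G2). y \<in> H e"
    and hs: "pbw_basis (eliminate N x k (G1 @ G2)) hs"
  shows "pbw_basis (G1 @ (x, k) # G2) ((x, k) # hs)"
proof -
  define G' where "G' = eliminate N x k (G1 @ G2)"
  let ?A = "fst ` set G' \<union> I" and ?B = "fst ` set (G1 @ (x, k) # G2)"
  have set_G': "set G' = {((bracket x ^^ n) y, e + n * k) | n y e.
      n \<le> N \<and> (y, e) \<in> set (G1 @ G2)}"
    by (simp add: G'_def set_eliminate)
  \<comment> \<open>Below \<open>N\<close> the next iterate is again in the list; after the last one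
    the degree is at least \<open>e + (N + 1) * k\<close>, hence the element falls into
    \<open>I\<close>.\<close>
  have ad: "bracket x y \<in> ?A" if y: "y \<in> ?A" for y
  proof (cases "y \<in> I")
    case False
    with y obtain p where "p \<in> set G'" "y = fst p" by auto
    then obtain n z e where z: "y = (bracket x ^^ n) z" "n \<le> N" "(z, e) \<in> set (G1 @ G2)"
      unfolding set_G' mem_Collect_eq by (metis fst_conv)
    show ?thesis
    proof (cases "n < N")
      case True
      with z have "((bracket x ^^ Suc n) z, e + Suc n * k) \<in> set G'"
        unfolding set_G' mem_Collect_eq
        by (intro exI[of _ "Suc n"] exI[of _ z] exI[of _ e]) auto
      then show ?thesis using z by force
    next
      case False
      have "(bracket x ^^ Suc n) z \<in> H (e + Suc n * k)"
        using H_funpow_bracket[OF x] z(3) G by blast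
      moreover have "e + Suc n * k > N"
        using k False z(2) mult_le_mono2[of 1 k "Suc n"] by auto
      ultimately show ?thesis using H_subset_I z by auto
    qed
  qed (use bracket_I in auto)
  have sub: "?B \<union> I \<subseteq> insert x ?A"
  proof -
    have "p \<in> set G'" if "p \<in> set (G1 @ G2)" for p
      using that unfolding set_G' mem_Collect_eq
      by (intro exI[of _ 0] exI[of _ "fst p"] exI[of _ "snd p"]) simp
    then have "fst ` set (G1 @ G2) \<subseteq> fst ` set G'" by blast
    then show ?thesis by auto
  qed
  have x_lie: "x \<in> lie_gen ?B" by (rule lie_gen_base) force
  have "y \<in> lie_gen ?B" if "y \<in> fst ` set G'" for y
  proof -
    from that obtain p where "p \<in> set G'" "y = fst p" by auto
    then obtain n z e where z: "y = (bracket x ^^ n) z" "(z, e) \<in> set (G1 @ G2)"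
      unfolding set_G' mem_Collect_eq by (metis fst_conv)
    have "z \<in> lie_gen ?B" by (rule lie_gen_base) (use z in force)
    then have "(bracket x ^^ n) z \<in> lie_gen ?B"
    proof (induction n)
      case (Suc n)
      from lie_gen_bracket[OF x_lie Suc.IH[OF Suc.prems]] show ?case unfolding funpow.simps(2) o_apply .
    qed (simp only: funpow.simps(1) id_apply)
    then show ?thesis unfolding z(1) .
  qed
  then have lie_sub: "lie_gen (fst ` set G') \<subseteq> lie_gen ?B"
    using lie_gen_subset_lie_gen by blast
  note hs' = hs[folded G'_def, unfolded pbw_basis_def]
  have 1: "\<forall>(h, e)\<in>set ((x, k) # hs). h \<in> H e \<and> e \<ge> 1 \<and> h \<in> lie_gen ?B"
    using hs' lie_sub x_lie x k by auto
  have 2: "lie_gen (?B \<union> I) \<subseteq> zspan (fst ` set ((x, k) # hs) \<union> I)"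
  proof
    fix v assume "v \<in> lie_gen (?B \<union> I)"
    then have "v \<in> zspan (insert x (lie_gen ?A))"
      by (rule lie_gen_eliminate[OF _ sub, rotated]) (intro lie_gen_base ad)
    then show "v \<in> zspan (fst ` set ((x, k) # hs) \<union> I)"
    proof (rule zspan_subset_zspan)
      fix s assume "s \<in> insert x (lie_gen ?A)"
      then consider "s = x" | "s \<in> zspan (fst ` set hs \<union> I)" using hs' by blast
      then show "s \<in> zspan (fst ` set ((x, k) # hs) \<union> I)"
      proof cases
        case 2
        then show ?thesis by (rule zspan_subset_zspan) (auto intro: zspan_base)
      qed (simp add: zspan_base)
    qed
  qed
  let ?M = "\<lambda>hs. {pbw_monomial (map fst hs) es | es. length es = length hs} \<union> I"
  have 3: "ring_gen (?B \<union> I) \<subseteq> zspan (?M ((x, k) # hs))"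
  proof
    fix v assume "v \<in> ring_gen (?B \<union> I)"
    then have "v \<in> zspan {x ^ i * m | i m. m \<in> ring_gen ?A}"
      by (rule ring_gen_eliminate[OF _ sub, rotated]) (intro ring_gen_base ad)
    then show "v \<in> zspan (?M ((x, k) # hs))"
    proof (rule zspan_subset_zspan)
      fix s assume "s \<in> {x ^ i * m | i m. m \<in> ring_gen ?A}"
      then obtain i m where s: "s = x ^ i * m" "m \<in> zspan (?M hs)" using hs' by blast
      show "s \<in> zspan (?M ((x, k) # hs))" unfolding s(1)
      proof (rule zspan_additive_image[OF s(2)])
        fix t assume "t \<in> ?M hs"
        then consider "t \<in> I" | es where "t = pbw_monomial (map fst hs) es" "length es = length hs"
          by blast
        then have "x ^ i * t \<in> ?M ((x, k) # hs)"
        proof cases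
          case 2
          then have "x ^ i * t = pbw_monomial (map fst ((x, k) # hs)) (i # es)" by simp
          with 2 show ?thesis by (metis (mono_tags, lifting) UnI1 length_Cons mem_Collect_eq)
        qed (simp add: I_mult_left)
        then show "x ^ i * t \<in> zspan (?M ((x, k) # hs))" by (rule zspan_base)
      qed (simp add: distrib_left)
    qed
  qed
  let ?P = "\<Prod>(h, e)\<leftarrow>hs. 1 - fps_X ^ e :: complex fps"
  \<comment> \<open>The error splits into the inherited error times \<open>1 - fps_X ^ k\<close> and
    the truncation error of the geometric sum, both divisible by
    \<open>fps_X ^ Suc N\<close>.\<close>
  have "(1 - fps_X ^ k) * ?P - (1 - degree_gf (G1 @ (x, k) # G2)) =
      (1 - fps_X ^ k) * (?P - (1 - degree_gf G')) +
      (1 - fps_X ^ k - (1 - fps_X ^ k) * degree_gf G' - (1 - degree_gf (G1 @ (x, k) # G2)))"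
    by (simp add: algebra_simps)
  also have "(1 - fps_X ^ k - (1 - fps_X ^ k) * degree_gf G' - (1 - degree_gf (G1 @ (x, k) # G2)))
      = fps_X ^ (Suc N * k) * degree_gf (G1 @ G2)"
    unfolding G'_def degree_gf_eliminate by (simp add: algebra_simps)
  finally have "(1 - fps_X ^ k) * ?P - (1 - degree_gf (G1 @ (x, k) # G2)) =
      (1 - fps_X ^ k) * (?P - (1 - degree_gf G')) + fps_X ^ (Suc N * k) * degree_gf (G1 @ G2)" .
  moreover have "fps_X ^ Suc N dvd (fps_X ^ (Suc N * k) :: complex fps)"
    using k mult_le_mono2[of 1 k "Suc N"] by (intro le_imp_power_dvd) simp
  ultimately have 4: "fps_X ^ Suc N dvd (\<Prod>(h, e)\<leftarrow>(x, k) # hs. 1 - fps_X ^ e)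
      - (1 - degree_gf (G1 @ (x, k) # G2))"
    using hs' by (simp del: power_Suc)
  show ?thesis unfolding pbw_basis_def using 1 2 3 4 by blast
qed

text \<open>The outer induction raises the least degree \<open>k\<close> until it exceeds
  \<open>N\<close>; the inner one counts the generators of degree exactly \<open>k\<close>.\<close>

theorem pbw_basis_exists:
  assumes "\<forall>(y, e)\<in>set G. y \<in> H e \<and> e \<ge> k" "k \<ge> 1"
  shows "\<exists>hs. pbw_basis G hs"
  using assms
proof (induction "Suc N - k" arbitrary: k G)
  case 0
  then show ?case using pbw_basis_high_degree[of G] by fastforce
next
  case (Suc j)
  note outer = Suc.hyps Suc.prems(2)
  from Suc.prems(1) show ?case
  proof (induction "length (filter (\<lambda>(y, e). e = k) G)" arbitrary: G)
    case 0
    then have "\<forall>(y, e)\<in>set G. y \<in> H e \<and> e \<ge> Suc k"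
      by (fastforce simp: filter_empty_conv)
    then show ?case using outer by (intro outer(1)[of "Suc k"]) auto
  next
    case (Suc c)
    then have "filter (\<lambda>(y, e). e = k) G \<noteq> []" by auto
    then obtain x where "(x, k) \<in> set G" by (auto simp: filter_empty_conv)
    then obtain G1 G2 where G: "G = G1 @ (x, k) # G2" by (meson split_list)
    have *: "\<forall>(y, e)\<in>set (G1 @ G2). y \<in> H e \<and> e \<ge> k" "x \<in> H k"
      using Suc.prems G by auto
    have "\<exists>hs. pbw_basis (eliminate N x k (G1 @ G2)) hs"
    proof (rule Suc.hyps(1))
      show "c = length (filter (\<lambda>(y, e). e = k) (eliminate N x k (G1 @ G2)))"
        using Suc.hyps(2) * outer(3) by (subst filter_eliminate_min_degree) (auto simp: G)
      show "\<forall>(y, e)\<in>set (eliminate N x k (G1 @ G2)). y \<in> H e \<and> e \<ge> k"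
        using * unfolding set_eliminate by (fastforce intro: H_funpow_bracket)
    qed
    then show ?case using pbw_basis_eliminate[of x k G1 G2] * outer(3) unfolding G by blast
  qed
qed

end

subsection \<open>Counting exponent vectors and words\<close>

definition exponents :: "nat list \<Rightarrow> nat \<Rightarrow> nat list set" where
  "exponents ds M = {es. length es = length ds \<and> sum_list (map2 (*) es ds) = M}"

lemma exponents_Nil: "exponents [] M = (if M = 0 then {[]} else {})"
  by (auto simp: exponents_def)

text \<open>The first exponent is zero or can be lowered by one. On generating functions this
  recursion is multiplication by \<open>1 - fps_X ^ d\<close>.\<close>

lemma exponents_Cons:
  "exponents (d # ds) M = (#) 0 ` exponents ds M \<union>
     (if d \<le> M then (\<lambda>es. Suc (hd es) # tl es) ` exponents (d # ds) (M - d) else {})"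
  (is "_ = ?R")
proof (intro subset_antisym subsetI)
  fix es assume es: "es \<in> exponents (d # ds) M"
  then obtain e es' where e: "es = e # es'" by (cases es) (auto simp: exponents_def)
  show "es \<in> ?R"
  proof (cases e)
    case 0
    then show ?thesis using es by (auto simp: e exponents_def)
  next
    case (Suc k)
    then have "d \<le> M" "k # es' \<in> exponents (d # ds) (M - d)"
      using es by (auto simp: e exponents_def)
    then have "Suc (hd (k # es')) # tl (k # es') \<in> ?R" by (metis (lifting) UnI2 imageI)
    then show ?thesis by (simp add: e Suc)
  qed
next
  fix es assume "es \<in> ?R"
  then show "es \<in> exponents (d # ds) M"
  proof
    assume "es \<in> (if d \<le> M then (\<lambda>es. Suc (hd es) # tl es) ` exponents (d # ds) (M - d) else {})"
    then obtain es' where "d \<le> M" "es = Suc (hd es') # tl es'" "es' \<in> exponents (d # ds) (M - d)"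
      by (auto split: if_splits)
    then show ?thesis by (cases es') (auto simp: exponents_def)
  qed (auto simp: exponents_def)
qed

lemma finite_exponents:
  assumes "\<forall>d\<in>set ds. d \<ge> 1"
  shows "finite (exponents ds M)"
  using assms
proof (induction ds arbitrary: M)
  case Nil
  then show ?case by (simp add: exponents_Nil)
next
  case (Cons d ds)
  show ?case
  proof (induction M rule: less_induct)
    case (less M)
    then show ?case using Cons by (subst exponents_Cons) auto
  qed
qed

lemma card_exponents_Cons:
  assumes "\<forall>x\<in>set (d # ds). x \<ge> 1"
  shows "card (exponents (d # ds) M) =
    card (exponents ds M) + (if d \<le> M then card (exponents (d # ds) (M - d)) else 0)"
proof -
  have "inj_on (\<lambda>es. Suc (hd es) # tl es) (exponents (d # ds) (M - d))"
  proof (rule inj_onI)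
    fix x y assume "x \<in> exponents (d # ds) (M - d)" "y \<in> exponents (d # ds) (M - d)"
      "Suc (hd x) # tl x = Suc (hd y) # tl y"
    then show "x = y" by (cases x; cases y) (auto simp: exponents_def)
  qed
  moreover have "inj_on ((#) 0) (exponents ds M)" by (auto intro: inj_onI)
  ultimately show ?thesis
    using finite_exponents[of ds M] finite_exponents[OF assms, of "M - d"] assms
    by (subst exponents_Cons) (auto simp: card_image intro!: card_Un_disjoint[THEN trans])
qed

lemma exponents_gf:
  assumes "\<forall>d\<in>set ds. d \<ge> 1"
  shows "Abs_fps (\<lambda>M. of_nat (card (exponents ds M))) * (\<Prod>d\<leftarrow>ds. 1 - fps_X ^ d)
    = (1 :: complex fps)"
  using assms
proof (induction ds)
  case Nil
  then show ?case by (auto simp: fps_eq_iff exponents_Nil)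
next
  case (Cons d ds)
  have "Abs_fps (\<lambda>M. of_nat (card (exponents (d # ds) M))) * (1 - fps_X ^ d)
    = (Abs_fps (\<lambda>M. of_nat (card (exponents ds M))) :: complex fps)"
    by (rule fps_ext)
       (simp add: right_diff_distrib fps_X_power_mult_right_nth card_exponents_Cons[OF Cons.prems])
  with Cons show ?case by (simp add: mult.assoc[symmetric])
qed

section \<open>Words of given degree and comparison with exponent vectors\<close>

definition words :: "'a set \<Rightarrow> ('a \<Rightarrow> nat) \<Rightarrow> nat \<Rightarrow> 'a list set" where
  "words X d n = {w \<in> lists X. wdeg d w = n}"

lemma wdeg_simps [simp]: "wdeg d [] = 0" "wdeg d (x # w) = d x + wdeg d w"
  "wdeg d (u @ v) = wdeg d u + wdeg d v"
  by (simp_all add: wdeg_def)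

lemma words_0:
  assumes "\<forall>x\<in>X. d x \<ge> 1"
  shows "words X d 0 = {[]}"
proof -
  have "w = []" if "w \<in> words X d 0" for w
    using that assms by (cases w) (auto simp: words_def)
  then show ?thesis by (auto simp: words_def)
qed

lemma words_pos:
  assumes "n > 0"
  shows "words X d n = (\<Union>x\<in>{x\<in>X. d x \<le> n}. (#) x ` words X d (n - d x))"
proof -
  have "w \<in> words X d n \<longleftrightarrow> w \<in> (\<Union>x\<in>{x\<in>X. d x \<le> n}. (#) x ` words X d (n - d x))" for w
    using assms by (cases w) (force simp: words_def image_iff)+
  then show ?thesis by blast
qed

context
  fixes X :: "'a set" and d :: "'a \<Rightarrow> nat"
  assumes finX: "finite X" and dpos: "\<forall>x\<in>X. d x \<ge> 1"
begin

lemma finite_words: "finite (words X d n)"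
proof (induction n rule: less_induct)
  case (less n)
  show ?case
  proof (cases "n = 0")
    case False
    then show ?thesis using finX dpos less by (subst words_pos) auto
  qed (simp add: words_0[OF dpos])
qed

lemma card_words_pos:
  assumes "n > 0"
  shows "card (words X d n) = (\<Sum>x\<in>{x\<in>X. d x \<le> n}. card (words X d (n - d x)))"
proof -
  have "card (words X d n) = (\<Sum>x\<in>{x\<in>X. d x \<le> n}. card ((#) x ` words X d (n - d x)))"
    unfolding words_pos[OF assms] using finX finite_words by (intro card_UN_disjoint) auto
  also have "\<dots> = (\<Sum>x\<in>{x\<in>X. d x \<le> n}. card (words X d (n - d x)))"
    by (intro sum.cong refl card_image) (auto intro: inj_onI)
  finally show ?thesis .
qed

lemma words_gf:
  "Abs_fps (\<lambda>n. of_nat (card (words X d n))) * (1 - (\<Sum>x\<in>X. fps_X ^ d x)) = (1 :: complex fps)"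
proof (rule fps_ext)
  fix n
  let ?W = "Abs_fps (\<lambda>n. of_nat (card (words X d n))) :: complex fps"
  have "(?W * (1 - (\<Sum>x\<in>X. fps_X ^ d x))) $ n =
      ?W $ n - (\<Sum>x\<in>X. if n < d x then 0 else ?W $ (n - d x))"
    by (simp add: right_diff_distrib sum_distrib_left fps_sum_nth fps_X_power_mult_right_nth)
  also have "(\<Sum>x\<in>X. if n < d x then 0 else ?W $ (n - d x)) =
      (\<Sum>x\<in>{x\<in>X. d x \<le> n}. ?W $ (n - d x))"
    using finX by (intro sum.mono_neutral_cong_right) auto
  also have "?W $ n - \<dots> = (1 :: complex fps) $ n"
  proof (cases "n = 0")
    case True
    then have "{x\<in>X. d x \<le> n} = {}" using dpos by fastforce
    with True show ?thesis unfolding True by (simp only:) (simp add: words_0[OF dpos])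
  next
    case False
    then show ?thesis by (simp add: card_words_pos)
  qed
  finally show "(?W * (1 - (\<Sum>x\<in>X. fps_X ^ d x))) $ n = (1 :: complex fps) $ n" .
qed

text \<open>The two counting series F and W are the inverses of the two products A and B, so W - F =
  F W (A - B) inherits the divisibility of A - B.\<close>

lemma card_exponents_eq_card_words:
  assumes ds: "\<forall>e\<in>set ds. e \<ge> 1"
    and dvd: "fps_X ^ Suc N dvd (\<Prod>e\<leftarrow>ds. 1 - fps_X ^ e) - (1 - (\<Sum>x\<in>X. fps_X ^ d x) :: complex fps)"
    and "M \<le> N"
  shows "card (exponents ds M) = card (words X d M)"
proof -
  let ?F = "Abs_fps (\<lambda>M. of_nat (card (exponents ds M))) :: complex fps"
  let ?W = "Abs_fps (\<lambda>n. of_nat (card (words X d n))) :: complex fps"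
  let ?A = "\<Prod>e\<leftarrow>ds. 1 - fps_X ^ e :: complex fps"
  let ?B = "1 - (\<Sum>x\<in>X. fps_X ^ d x) :: complex fps"
  have "?F * ?W * (?A - ?B) = (?F * ?A) * ?W - ?F * (?W * ?B)"
    by (simp only: right_diff_distrib mult_ac)
  also have "\<dots> = ?W - ?F"
    unfolding exponents_gf[OF ds] words_gf by simp
  finally have "fps_X ^ Suc N dvd ?W - ?F"
    using dvd by (metis dvd_mult)
  then obtain u where u: "?W - ?F = fps_X ^ Suc N * u" by (elim dvdE)
  have "(?W - ?F) $ M = 0" unfolding u
    using \<open>M \<le> N\<close> by (subst fps_X_power_mult_nth) simp
  then have "(of_nat (card (words X d M)) :: complex) = of_nat (card (exponents ds M))" by simp
  then show ?thesis by (simp only: of_nat_eq_iff)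
qed

end

subsection \<open>Linear independence over the integers\<close>

text \<open>Gaussian elimination over the integers, with cross-multiplication by the pivot in place
  of division.\<close>

lemma homogeneous_system_nontrivial_solution:
  fixes a :: "'i \<Rightarrow> 'j \<Rightarrow> int"
  assumes "finite J" "finite I" "card J < card I"
  shows "\<exists>c. (\<exists>i\<in>I. c i \<noteq> 0) \<and> (\<forall>j\<in>J. (\<Sum>i\<in>I. c i * a i j) = 0)"
  using assms
proof (induction J arbitrary: I a rule: finite_induct)
  case empty
  then have "I \<noteq> {}" by auto
  then show ?case by (intro exI[of _ "\<lambda>_. 1"]) auto
next
  case (insert j J)
  show ?case
  proof (cases "\<forall>i\<in>I. a i j = 0")
    case True
    have "\<exists>c. (\<exists>i\<in>I. c i \<noteq> 0) \<and> (\<forall>j\<in>J. (\<Sum>i\<in>I. c i * a i j) = 0)"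
      using insert by (intro insert.IH) auto
    with True show ?thesis by auto
  next
    case False
    then obtain p where p: "p \<in> I" "a p j \<noteq> 0" by blast
    define I' where "I' = I - {p}"
    have I: "I = insert p I'" "p \<notin> I'" "finite I'" using p insert.prems by (auto simp: I'_def)
    have "card J < card I'" using insert.prems insert.hyps by (simp add: I)
    from insert.IH[OF I(3) this, of "\<lambda>i k. a p j * a i k - a i j * a p k"]
    obtain c where c: "\<exists>i\<in>I'. c i \<noteq> 0"
      "\<And>k. k \<in> J \<Longrightarrow> (\<Sum>i\<in>I'. c i * (a p j * a i k - a i j * a p k)) = 0" by blast
    \<comment> \<open>The value at \<open>p\<close> is forced by equation \<open>j\<close>; scaling
      the other values by the pivot \<open>a p j\<close> keeps it integral.\<close>
    define c' where "c' i = (if i = p then - (\<Sum>i\<in>I'. c i * a i j) else a p j * c i)" for i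
    have c'_I': "c' i = a p j * c i" if "i \<in> I'" for i
      using that I(2) by (auto simp: c'_def)
    have sum: "(\<Sum>i\<in>I. c' i * a i k) =
        (\<Sum>i\<in>I'. c i * (a p j * a i k - a i j * a p k))" for k
    proof -
      have "(\<Sum>i\<in>I. c' i * a i k) = c' p * a p k + (\<Sum>i\<in>I'. a p j * c i * a i k)"
        unfolding I(1) using I by (simp add: c'_I')
      also have "c' p * a p k = - (\<Sum>i\<in>I'. c i * a i j * a p k)"
        by (simp add: c'_def sum_distrib_right)
      finally show ?thesis by (simp add: algebra_simps sum_subtractf)
    qed
    have "(\<Sum>i\<in>I. c' i * a i k) = 0" if "k \<in> insert j J" for k
      using that c(2) unfolding sum by (cases "k = j") (auto simp: algebra_simps)
    moreover have "\<exists>i\<in>I. c' i \<noteq> 0" using c(1) p c'_I' I by force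
    ultimately show ?thesis by blast
  qed
qed

definition indep_family :: "'i set \<Rightarrow> ('i \<Rightarrow> 'w \<Rightarrow> int) \<Rightarrow> bool" where
  "indep_family I u \<longleftrightarrow> (\<forall>c. (\<forall>w. (\<Sum>i\<in>I. c i * u i w) = 0) \<longrightarrow> (\<forall>i\<in>I. c i = 0))"

definition spans_family :: "'j set \<Rightarrow> ('j \<Rightarrow> 'w \<Rightarrow> int) \<Rightarrow> ('w \<Rightarrow> int) \<Rightarrow> bool" where
  "spans_family J v u \<longleftrightarrow> (\<exists>b. \<forall>w. u w = (\<Sum>j\<in>J. b j * v j w))"

text \<open>If \<open>I\<close> were larger, the rows of coefficients would satisfy a nontrivial
  integer relation, which passes to the \<open>u i\<close>.\<close>

lemma card_indep_family_le:
  assumes "finite I" "finite J" "indep_family I u" "\<And>i. i \<in> I \<Longrightarrow> spans_family J v (u i)"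
  shows "card I \<le> card J"
proof (rule ccontr)
  assume "\<not> card I \<le> card J"
  obtain b where b: "\<And>i w. i \<in> I \<Longrightarrow> u i w = (\<Sum>j\<in>J. b i j * v j w)"
    using assms(4) unfolding spans_family_def by metis
  obtain c where c: "\<exists>i\<in>I. c i \<noteq> 0" "\<And>j. j \<in> J \<Longrightarrow> (\<Sum>i\<in>I. c i * b i j) = 0"
    using homogeneous_system_nontrivial_solution[OF assms(2,1), of b] \<open>\<not> card I \<le> card J\<close> by force
  have "(\<Sum>i\<in>I. c i * u i w) = 0" for w
  proof -
    have "(\<Sum>i\<in>I. c i * u i w) = (\<Sum>i\<in>I. \<Sum>j\<in>J. c i * b i j * v j w)"
      by (intro sum.cong) (simp_all add: b sum_distrib_left mult.assoc)
    also have "\<dots> = (\<Sum>j\<in>J. (\<Sum>i\<in>I. c i * b i j) * v j w)"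
      by (subst sum.swap) (simp add: sum_distrib_right)
    finally show ?thesis using c(2) by simp
  qed
  with assms(3) c(1) show False unfolding indep_family_def by blast
qed

text \<open>A relation with \<open>c p\<close> nonzero expresses \<open>c p\<close> times each
  \<open>u i\<close> through \<open>J - {p}\<close>. The scaled family is still independent, so it
  would be larger than a family spanning it.\<close>

lemma indep_family_if_spanning:
  assumes fin: "finite I" "finite J" and u: "indep_family I u"
    and span: "\<And>i. i \<in> I \<Longrightarrow> spans_family J v (u i)" and card: "card J \<le> card I"
  shows "indep_family J v"
  unfolding indep_family_def
proof (intro allI impI ballI, rule ccontr)
  fix c p assume c: "\<forall>w. (\<Sum>j\<in>J. c j * v j w) = 0" and p: "p \<in> J" "c p \<noteq> 0"
  have "indep_family I (\<lambda>i w. c p * u i w)"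
    unfolding indep_family_def
  proof (intro allI impI)
    fix a assume "\<forall>w. (\<Sum>i\<in>I. a i * (c p * u i w)) = 0"
    then have "c p * (\<Sum>i\<in>I. a i * u i w) = 0" for w
      by (simp add: sum_distrib_left mult_ac)
    with p u show "\<forall>i\<in>I. a i = 0" unfolding indep_family_def by simp
  qed
  moreover have "spans_family (J - {p}) v (\<lambda>w. c p * u i w)" if i: "i \<in> I" for i
  proof -
    obtain b where b: "\<And>w. u i w = (\<Sum>j\<in>J. b j * v j w)"
      using span[OF i] unfolding spans_family_def by blast
    have "c p * u i w = (\<Sum>j\<in>J - {p}. (c p * b j - b p * c j) * v j w)" for w
    proof -
      have "c p * u i w = c p * (\<Sum>j\<in>J. b j * v j w) - b p * (\<Sum>j\<in>J. c j * v j w)"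
        using c b by simp
      also have "\<dots> = (\<Sum>j\<in>J. (c p * b j - b p * c j) * v j w)"
        by (simp add: sum_distrib_left sum_subtractf[symmetric] algebra_simps)
      also have "\<dots> = (\<Sum>j\<in>J - {p}. (c p * b j - b p * c j) * v j w)"
        using fin p by (simp add: sum.remove[of J p] mult.commute)
      finally show ?thesis .
    qed
    then show ?thesis unfolding spans_family_def
      by (intro exI[of _ "\<lambda>j. c p * b j - b p * c j"]) blast
  qed
  ultimately have "card I \<le> card (J - {p})"
    using fin by (intro card_indep_family_le[where v = v]) auto
  moreover have "card (J - {p}) < card J" using fin p by (intro psubset_card_mono) auto
  ultimately show False using card by linarith
qed

lemma indep_family_reindex:
  assumes "finite J" "indep_family J v" "inj_on g K" "g ` K \<subseteq> J"
  shows "indep_family K (\<lambda>k. v (g k))"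
  unfolding indep_family_def
proof (intro allI impI)
  fix c assume c: "\<forall>w. (\<Sum>k\<in>K. c k * v (g k) w) = 0"
  define c' where "c' j = (if j \<in> g ` K then c (inv_into K g j) else 0)" for j
  have c': "c' (g k) = c k" if "k \<in> K" for k
    using that assms(3) by (auto simp: c'_def)
  have "(\<Sum>j\<in>J. c' j * v j w) = 0" for w
  proof -
    have "(\<Sum>j\<in>J. c' j * v j w) = (\<Sum>j\<in>g ` K. c' j * v j w)"
      using assms by (intro sum.mono_neutral_right) (auto simp: c'_def)
    also have "\<dots> = (\<Sum>k\<in>K. c k * v (g k) w)"
      using assms(3) c' by (simp add: sum.reindex)
    finally show ?thesis using c by simp
  qed
  with assms(2) have "\<forall>j\<in>J. c' j = 0" unfolding indep_family_def by blast
  then show "\<forall>k\<in>K. c k = 0" using c' assms(4) by (metis imageI subsetD)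
qed

lemma indep_family_inj_on:
  assumes "finite K" "indep_family K v"
  shows "inj_on v K"
proof (rule inj_onI, rule ccontr)
  fix i j assume ij: "i \<in> K" "j \<in> K" "v i = v j" "i \<noteq> j"
  let ?c = "\<lambda>k. if k = i then 1 else if k = j then - 1 else 0 :: int"
  have "(\<Sum>k\<in>K. ?c k * v k w) = 0" for w
  proof -
    have "(\<Sum>k\<in>K. ?c k * v k w) = (\<Sum>k\<in>{i, j}. ?c k * v k w)"
      using assms ij by (intro sum.mono_neutral_right) auto
    then show ?thesis using ij by simp
  qed
  moreover have "(\<forall>w. (\<Sum>k\<in>K. ?c k * v k w) = 0) \<longrightarrow> (\<forall>k\<in>K. ?c k = 0)"
    using assms(2) unfolding indep_family_def by (rule spec)
  ultimately have "\<forall>k\<in>K. ?c k = 0" by blast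
  then have "?c i = 0" using ij(1) by blast
  then show False by simp
qed

lemma int_lin_indep_iff: "int_lin_indep S \<longleftrightarrow> indep_family S (\<lambda>s. s)"
  unfolding int_lin_indep_def indep_family_def by simp

text \<open>An integral basis, given as a family, has the maximal size among independent finite
  subsets, so the supremum is attained.\<close>

lemma zrank_eqI:
  assumes "finite K" "indep_family K v" "v ` K \<subseteq> M" "\<And>u. u \<in> M \<Longrightarrow> spans_family K v u"
  shows "zrank M = card K"
  unfolding zrank_def
proof (rule cSup_eq_maximum)
  have inj: "inj_on v K" by (rule indep_family_inj_on[OF assms(1,2)])
  have "indep_family (v ` K) (\<lambda>s. s)"
    unfolding indep_family_def
  proof (intro allI impI)
    fix c assume "\<forall>w. (\<Sum>i\<in>v ` K. c i * i w) = 0"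
    then have "\<forall>w. (\<Sum>i\<in>K. c (v i) * v i w) = 0" by (simp add: sum.reindex[OF inj])
    with assms(2) show "\<forall>i\<in>v ` K. c i = 0"
      unfolding indep_family_def by (auto dest: spec[of _ "\<lambda>i. c (v i)"])
  qed
  then show "card K \<in> {card S |S. finite S \<and> S \<subseteq> M \<and> int_lin_indep S}"
    using assms card_image[OF inj] by (force simp: int_lin_indep_iff intro!: exI[of _ "v ` K"])
next
  fix n assume "n \<in> {card S |S. finite S \<and> S \<subseteq> M \<and> int_lin_indep S}"
  then show "n \<le> card K"
    using assms(1,4) by (auto simp: int_lin_indep_iff intro!: card_indep_family_le[where v = v])
qed

subsection \<open>The rank of a homogeneous component of the free Lie ring\<close>

definition nc_letter :: "'a \<Rightarrow> 'a nc_series" where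
  "nc_letter x = Nc_series (letter x)"

lemma nc_coeff_letter [simp]: "nc_coeff (nc_letter x) = letter x"
  by (simp add: nc_letter_def)

lemma nc_coeff_bracket: "nc_coeff (bracket f g) = lie_br (nc_coeff f) (nc_coeff g)"
  by (rule ext) (simp add: bracket_def lie_br_def nc_coeff_mult)

lemma free_lie_iff_lie_gen:
  "nc_coeff f \<in> free_lie X \<longleftrightarrow> f \<in> lie_gen (nc_letter ` X)"
proof
  assume "f \<in> lie_gen (nc_letter ` X)"
  then show "nc_coeff f \<in> free_lie X"
  proof induction
    case (lie_gen_base f)
    then show ?case by (auto intro: free_lie.gen)
  next
    case lie_gen_0
    then show ?case using free_lie.zero by (simp add: zero_nc_series_def)
  next
    case (lie_gen_add f g)
    then show ?case using free_lie.add by (simp add: plus_nc_series_def)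
  next
    case (lie_gen_minus f)
    then show ?case using free_lie.neg by (simp add: uminus_nc_series_def)
  next
    case (lie_gen_bracket f g)
    then show ?case using free_lie.br by (simp add: nc_coeff_bracket)
  qed
next
  have "Nc_series u \<in> lie_gen (nc_letter ` X)" if "u \<in> free_lie X" for u
    using that
  proof induction
    case (gen x)
    then show ?case by (auto simp flip: nc_letter_def intro: lie_gen.intros)
  next
    case zero
    show ?case using lie_gen_0[of "nc_letter ` X"] by (simp add: zero_nc_series_def)
  next
    case (add f g)
    from lie_gen_add[OF add.IH] show ?case by (simp add: plus_nc_series_def)
  next
    case (neg f)
    from lie_gen_minus[OF neg.IH] show ?case by (simp add: uminus_nc_series_def)
  next
    case (br f g)
    have "Nc_series (lie_br f g) = bracket (Nc_series f) (Nc_series g)"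
      by (rule nc_series_eqI) (simp add: nc_coeff_bracket)
    with lie_gen_bracket[OF br.IH] show ?case by simp
  qed
  then show "nc_coeff f \<in> free_lie X \<Longrightarrow> f \<in> lie_gen (nc_letter ` X)"
    using nc_coeff_inverse[of f] by fastforce
qed

text \<open>Products of letters are the indicator functions of words, which makes their independence
  immediate.\<close>

lemma nc_coeff_prod_letters:
  "nc_coeff (prod_list (map nc_letter w)) v = (if v = w then 1 else 0)"
proof (induction w arbitrary: v)
  case Nil
  then show ?case by (simp add: nc_coeff_1)
next
  case (Cons x w)
  show ?case
  proof (cases v)
    case Nil
    then show ?thesis by (simp add: nc_coeff_mult letter_def)
  next
    case (Cons a v')
    let ?f = "nc_coeff (prod_list (map nc_letter w))"
    have "(\<lambda>u. letter x (a # u)) = (\<lambda>u. (if a = x then 1 else 0) * (if u = [] then 1 else 0))"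
      by (auto simp: letter_def)
    then have "amul (letter x) ?f (a # v') = (if a = x then 1 else 0) * ?f v'"
      by (simp only: amul_Cons amul_scale_left amul_one_left) (simp add: letter_def)
    then show ?thesis using Cons.IH[of v'] Cons by (simp add: nc_coeff_mult)
  qed
qed

lemma prod_letters_in_ring_gen:
  "w \<in> lists X \<Longrightarrow> prod_list (map nc_letter w) \<in> ring_gen (nc_letter ` X)"
  by (induction w) (auto intro: ring_gen.intros)

section \<open>The grading of the series ring\<close>

definition homogeneous :: "('a \<Rightarrow> nat) \<Rightarrow> nat \<Rightarrow> 'a nc_series set" where
  "homogeneous d n = {f. \<forall>w. nc_coeff f w \<noteq> 0 \<longrightarrow> wdeg d w = n}"

definition high_degree :: "('a \<Rightarrow> nat) \<Rightarrow> nat \<Rightarrow> 'a nc_series set" where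
  "high_degree d n = {f. \<forall>w. nc_coeff f w \<noteq> 0 \<longrightarrow> wdeg d w > n}"

text \<open>This additive projection turns a statement modulo \<open>high_degree d N\<close> into an
  exact one in degree \<open>N\<close>.\<close>

definition component :: "('a \<Rightarrow> nat) \<Rightarrow> nat \<Rightarrow> 'a nc_series \<Rightarrow> 'a nc_series" where
  "component d n f = Nc_series (\<lambda>w. if wdeg d w = n then nc_coeff f w else 0)"

lemma component_add: "component d n (f + g) = component d n f + component d n g"
  by (rule nc_series_eqI) (simp add: component_def)

lemma component_homogeneous: "f \<in> homogeneous d m \<Longrightarrow> component d n f = (if m = n then f else 0)"
  by (rule nc_series_eqI) (auto simp: component_def homogeneous_def)

lemma component_high_degree: "f \<in> high_degree d N \<Longrightarrow> n \<le> N \<Longrightarrow> component d n f = 0"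
  by (rule nc_series_eqI) (auto simp: component_def high_degree_def)

lemma nc_coeff_mult_nonzeroD:
  assumes "nc_coeff (f * g) w \<noteq> 0"
  obtains u v where "w = u @ v" "nc_coeff f u \<noteq> 0" "nc_coeff g v \<noteq> 0"
proof -
  have "(\<Sum>i\<le>length w. nc_coeff f (take i w) * nc_coeff g (drop i w)) \<noteq> 0"
    using assms by (simp add: nc_coeff_mult amul_def)
  then obtain i where "nc_coeff f (take i w) * nc_coeff g (drop i w) \<noteq> 0"
    by (rule sum.not_neutral_contains_not_neutral)
  then show ?thesis using that[of "take i w" "drop i w"] by auto
qed

lemma homogeneous_mult:
  assumes "f \<in> homogeneous d m" "g \<in> homogeneous d n"
  shows "f * g \<in> homogeneous d (m + n)"
  unfolding homogeneous_def
proof (safe)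
  fix w assume "nc_coeff (f * g) w \<noteq> 0"
  then obtain u v where "w = u @ v" "nc_coeff f u \<noteq> 0" "nc_coeff g v \<noteq> 0"
    by (rule nc_coeff_mult_nonzeroD)
  with assms show "wdeg d w = m + n" by (simp add: homogeneous_def)
qed

lemma homogeneous_1: "1 \<in> homogeneous d 0"
  by (simp add: homogeneous_def nc_coeff_1)

lemma homogeneous_power: "f \<in> homogeneous d m \<Longrightarrow> f ^ k \<in> homogeneous d (k * m)"
  by (induction k) (auto intro: homogeneous_mult homogeneous_1)

lemma homogeneous_prod_letters: "prod_list (map nc_letter w) \<in> homogeneous d (wdeg d w)"
  by (auto simp: homogeneous_def nc_coeff_prod_letters split: if_splits)

lemma pbw_monomial_homogeneous:
  assumes "\<forall>(h, e)\<in>set hs. h \<in> homogeneous d e" "length es = length hs"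
  shows "pbw_monomial (map fst hs) es \<in> homogeneous d (sum_list (map2 (*) es (map snd hs)))"
  using assms(2,1)
proof (induction es hs rule: list_induct2)
  case Nil
  then show ?case by (simp add: homogeneous_1)
next
  case (Cons k es p hs)
  then show ?case by (auto intro!: homogeneous_mult homogeneous_power)
qed

lemma graded_ring_mod_ideal_nc_series:
  "graded_ring_mod_ideal (homogeneous d) (high_degree d N) N"
proof
  fix f g :: "'a nc_series" and m n
  show "f \<in> homogeneous d m \<Longrightarrow> g \<in> homogeneous d n \<Longrightarrow> f * g \<in> homogeneous d (m + n)"
    by (rule homogeneous_mult)
  show "f \<in> homogeneous d n \<Longrightarrow> g \<in> homogeneous d n \<Longrightarrow> f - g \<in> homogeneous d n"
    by (simp add: homogeneous_def) (metis cancel_comm_monoid_add_class.diff_cancel)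
  show "n > N \<Longrightarrow> homogeneous d n \<subseteq> high_degree d N"
    by (auto simp: homogeneous_def high_degree_def)
  show "0 \<in> high_degree d N"
    by (simp add: high_degree_def)
  show "f \<in> high_degree d N \<Longrightarrow> g \<in> high_degree d N \<Longrightarrow> f - g \<in> high_degree d N"
    by (simp add: high_degree_def) (metis cancel_comm_monoid_add_class.diff_cancel)
  show "f * g \<in> high_degree d N" if "g \<in> high_degree d N"
    unfolding high_degree_def
  proof safe
    fix w assume "nc_coeff (f * g) w \<noteq> 0"
    then obtain u v where "w = u @ v" "nc_coeff f u \<noteq> 0" "nc_coeff g v \<noteq> 0"
      by (rule nc_coeff_mult_nonzeroD)
    with that show "N < wdeg d w" by (fastforce simp: high_degree_def)
  qed
  show "f * g \<in> high_degree d N" if "f \<in> high_degree d N"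
    unfolding high_degree_def
  proof safe
    fix w assume "nc_coeff (f * g) w \<noteq> 0"
    then obtain u v where "w = u @ v" "nc_coeff f u \<noteq> 0" "nc_coeff g v \<noteq> 0"
      by (rule nc_coeff_mult_nonzeroD)
    with that show "N < wdeg d w" by (fastforce simp: high_degree_def)
  qed
qed

lemma spans_family_if_zspan:
  assumes "f \<in> zspan (v ` J)" "finite J"
  shows "spans_family J (\<lambda>j. nc_coeff (v j)) (nc_coeff f)"
proof -
  obtain c where "f = (\<Sum>j\<in>J. of_int (c j) * v j)" using zspan_image_sum[OF assms] ..
  then have "\<forall>w. nc_coeff f w = (\<Sum>j\<in>J. c j * nc_coeff (v j) w)"
    by (simp add: nc_coeff_of_int_mult)
  then show ?thesis unfolding spans_family_def by (intro exI[of _ c])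
qed

lemma indep_family_words:
  "indep_family W (\<lambda>w. nc_coeff (prod_list (map nc_letter w)))" if "finite W"
  unfolding indep_family_def using that
  by (auto simp: nc_coeff_prod_letters if_distrib[of "(*) _"] cong: if_cong)

text \<open>Each Lie element is itself a monomial, so the independence of the monomials passes to
  the Lie elements.\<close>

lemma pbw_monomial_unit:
  "i < length hs \<Longrightarrow> pbw_monomial hs ((replicate (length hs) 0)[i := 1]) = hs ! i"
proof (induction hs arbitrary: i)
  case (Cons h hs)
  have "pbw_monomial hs (replicate (length hs) 0) = 1"
    by (induction hs) auto
  with Cons show ?case by (cases i) auto
qed simp

lemma weighted_sum_unit:
  fixes ds :: "nat list"
  shows "i < length ds \<Longrightarrow> sum_list (map2 (*) ((replicate (length ds) 0)[i := k]) ds) = k * ds ! i"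
proof (induction ds arbitrary: i)
  case (Cons e ds)
  have "sum_list (map2 (*) (replicate (length ds) 0) ds) = 0"
    by (induction ds) auto
  with Cons show ?case by (cases i) auto
qed simp

theorem zrank_lie_comp:
  fixes X :: "'a set" and d :: "'a \<Rightarrow> nat"
  assumes X: "finite X" and d: "\<forall>x\<in>X. d x \<ge> 1"
  obtains ds where "\<forall>e\<in>set ds. e \<ge> 1"
    and "fps_X ^ Suc N dvd (\<Prod>e\<leftarrow>ds. 1 - fps_X ^ e) - (1 - (\<Sum>x\<in>X. fps_X ^ d x) :: complex fps)"
    and "card (exponents ds N) = card (words X d N)"
    and "zrank (lie_comp X d N) = card {i. i < length ds \<and> ds ! i = N}"
proof -
  interpret graded_ring_mod_ideal "homogeneous d" "high_degree d N" N
    by (rule graded_ring_mod_ideal_nc_series)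
  obtain xs where xs: "set xs = X" "distinct xs" using X finite_distinct_list by blast
  let ?G = "map (\<lambda>x. (nc_letter x, d x)) xs"
  have fst_G: "fst ` set ?G = nc_letter ` X" by (auto simp: xs(1) image_image)
  have "\<forall>(y, e)\<in>set ?G. y \<in> homogeneous d e \<and> e \<ge> 1"
    using d xs homogeneous_prod_letters[of "[_]" d] by auto
  from pbw_basis_exists[OF this] obtain hs where hs: "pbw_basis ?G hs" by auto
  define ds where "ds = map snd hs"
  have len: "length ds = length hs" by (simp add: ds_def)
  have ds_pos: "\<forall>e\<in>set ds. e \<ge> 1" using hs by (auto simp: ds_def pbw_basis_def)
  have hom: "\<forall>(h, e)\<in>set hs. h \<in> homogeneous d e" using hs by (auto simp: pbw_basis_def)
  have "degree_gf ?G = (\<Sum>x\<in>X. fps_X ^ d x)"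
    using xs by (simp add: degree_gf_def o_def sum_list_distinct_conv_sum_set)
  moreover have "(\<Prod>(h, e)\<leftarrow>hs. 1 - fps_X ^ e) = (\<Prod>e\<leftarrow>ds. 1 - fps_X ^ e :: complex fps)"
    by (simp add: ds_def o_def case_prod_unfold)
  ultimately have dvd: "fps_X ^ Suc N dvd
      (\<Prod>e\<leftarrow>ds. 1 - fps_X ^ e) - (1 - (\<Sum>x\<in>X. fps_X ^ d x) :: complex fps)"
    using hs unfolding pbw_basis_def by (simp only:)
  have card: "card (exponents ds N) = card (words X d N)"
    by (rule card_exponents_eq_card_words[OF X d ds_pos dvd]) simp
  let ?J = "exponents ds N"
  let ?mon = "pbw_monomial (map fst hs)"
  have fin_J: "finite ?J" by (rule finite_exponents[OF ds_pos])
  \<comment> \<open>Projection to degree \<open>N\<close> fixes the word, kills the ideal and every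
    monomial of another degree, and leaves the monomials in \<open>?J\<close>.\<close>
  have words_span: "prod_list (map nc_letter w) \<in> zspan (?mon ` ?J)" if w: "w \<in> words X d N" for w
  proof -
    let ?w = "prod_list (map nc_letter w)"
    have "?w \<in> ring_gen (nc_letter ` X)"
      using w by (intro prod_letters_in_ring_gen) (auto simp: words_def)
    then have "?w \<in> ring_gen (nc_letter ` X \<union> high_degree d N)"
      by (induction) (auto intro: ring_gen.intros)
    then have "?w \<in> zspan ({?mon es | es. length es = length hs} \<union> high_degree d N)"
      using hs unfolding pbw_basis_def fst_G by blast
    then have "component d N ?w \<in> zspan (?mon ` ?J)"
    proof (rule zspan_additive_image)
      fix s assume "s \<in> {?mon es | es. length es = length hs} \<union> high_degree d N"
      then consider "s \<in> high_degree d N" | es where "s = ?mon es" "length es = length hs" by blast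
      then show "component d N s \<in> zspan (?mon ` ?J)"
      proof cases
        case 1
        then show ?thesis by (simp add: component_high_degree zspan_0)
      next
        case 2
        then have "component d N s = (if sum_list (map2 (*) es ds) = N then ?mon es else 0)"
          unfolding ds_def by (simp add: component_homogeneous[OF pbw_monomial_homogeneous[OF hom]])
        then show ?thesis
          using 2 by (auto simp: exponents_def len intro: zspan_0 zspan_base)
      qed
    qed (rule component_add)
    moreover have "component d N ?w = ?w"
      using w component_homogeneous[OF homogeneous_prod_letters[of w d]] by (auto simp: words_def)
    ultimately show ?thesis by simp
  qed
  \<comment> \<open>The words are independent and spanned by equally many monomials.\<close>
  have indep_J: "indep_family ?J (\<lambda>j. nc_coeff (?mon j))"
    by (rule indep_family_if_spanning[OF finite_words[OF X d, of N] fin_J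
          indep_family_words[OF finite_words[OF X d, of N]]])
       (simp_all add: spans_family_if_zspan words_span fin_J card)
  define K where "K = {i. i < length ds \<and> ds ! i = N}"
  let ?unit = "\<lambda>i. (replicate (length ds) 0)[i := 1 :: nat]"
  have unit: "inj_on ?unit K" "?unit ` K \<subseteq> ?J"
  proof (rule inj_onI)
    fix i j assume ij: "i \<in> K" "j \<in> K" "?unit i = ?unit j"
    then have "?unit i ! j = 1" by (simp add: K_def)
    moreover have "?unit i ! j = 0" if "i \<noteq> j" using that ij(2) by (simp add: K_def)
    ultimately show "i = j" by fastforce
  next
    show "?unit ` K \<subseteq> ?J" by (auto simp: exponents_def K_def weighted_sum_unit)
  qed
  have mon_unit: "?mon (?unit i) = fst (hs ! i)" if "i \<in> K" for i
    using that pbw_monomial_unit[of i "map fst hs"] by (simp add: K_def len)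
  have "indep_family K (\<lambda>i. nc_coeff (?mon (?unit i)))"
    by (rule indep_family_reindex[OF fin_J indep_J unit])
  then have indep_K: "indep_family K (\<lambda>i. nc_coeff (fst (hs ! i)))"
    by (simp add: indep_family_def mon_unit[unfolded One_nat_def])
  have fin_K: "finite K" by (simp add: K_def)
  have in_L: "nc_coeff (fst (hs ! i)) \<in> lie_comp X d N" if "i \<in> K" for i
  proof -
    have i: "(fst (hs ! i), N) \<in> set hs"
      using that by (auto simp: K_def ds_def in_set_conv_nth intro!: exI[of _ i])
    then have "fst (hs ! i) \<in> lie_gen (nc_letter ` X)" "fst (hs ! i) \<in> homogeneous d N"
      using hs unfolding pbw_basis_def fst_G by auto
    then show ?thesis by (simp add: lie_comp_def homogeneous_def free_lie_iff_lie_gen)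
  qed
  have span_K: "spans_family K (\<lambda>i. nc_coeff (fst (hs ! i))) u" if u: "u \<in> lie_comp X d N" for u
  proof -
    define f where "f = Nc_series u"
    have f: "f \<in> lie_gen (nc_letter ` X)" "f \<in> homogeneous d N"
      using u by (auto simp: f_def lie_comp_def homogeneous_def simp flip: free_lie_iff_lie_gen)
    have "f \<in> lie_gen (nc_letter ` X \<union> high_degree d N)"
      using f(1) by (rule lie_gen_subset_lie_gen) (auto intro: lie_gen.intros)
    then have "f \<in> zspan (fst ` set hs \<union> high_degree d N)"
      using hs unfolding pbw_basis_def fst_G by blast
    then have "component d N f \<in> zspan ((\<lambda>i. fst (hs ! i)) ` K)"
    proof (rule zspan_additive_image)
      fix s assume "s \<in> fst ` set hs \<union> high_degree d N"
      then consider "s \<in> high_degree d N" | i where "i < length hs" "s = fst (hs ! i)"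
        by (metis UnE imageE in_set_conv_nth)
      then show "component d N s \<in> zspan ((\<lambda>i. fst (hs ! i)) ` K)"
      proof cases
        case 1
        then show ?thesis by (simp add: component_high_degree zspan_0)
      next
        case 2
        then have "s \<in> homogeneous d (ds ! i)" using hom by (force simp: ds_def dest: nth_mem)
        from component_homogeneous[OF this, of N] 2 show ?thesis
          by (auto simp: K_def len intro: zspan_0 zspan_base)
      qed
    qed (rule component_add)
    then have "f \<in> zspan ((\<lambda>i. fst (hs ! i)) ` K)"
      using component_homogeneous[OF f(2), of N] by simp
    from spans_family_if_zspan[OF this fin_K] show ?thesis by (simp add: f_def)
  qed
  have "zrank (lie_comp X d N) = card K"
    using in_L span_K by (intro zrank_eqI[OF fin_K indep_K]) auto
  with that ds_pos dvd card show thesis unfolding K_def by blast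
qed

unbundle no vec_syntax

subsection \<open>Power sums of the roots\<close>

text \<open>\<open>U\<close> is minus the logarithmic derivative \<open>t f' / f\<close>, stated without division.\<close>

definition has_neg_log_deriv :: "complex fps \<Rightarrow> complex fps \<Rightarrow> bool" where
  "has_neg_log_deriv f U \<longleftrightarrow> fps_X * fps_deriv f = - (f * U)"

lemma has_neg_log_deriv_1: "has_neg_log_deriv 1 0"
  by (simp add: has_neg_log_deriv_def)

lemma has_neg_log_deriv_mult:
  assumes "has_neg_log_deriv f U" "has_neg_log_deriv g V"
  shows "has_neg_log_deriv (f * g) (U + V)"
proof -
  have "fps_X * fps_deriv (f * g) = (fps_X * fps_deriv f) * g + f * (fps_X * fps_deriv g)"
    by (simp add: algebra_simps)
  also have "\<dots> = - (f * g * (U + V))"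
    using assms unfolding has_neg_log_deriv_def by (simp add: algebra_simps)
  finally show ?thesis by (simp add: has_neg_log_deriv_def)
qed

lemma has_neg_log_deriv_power:
  "has_neg_log_deriv f U \<Longrightarrow> has_neg_log_deriv (f ^ k) (of_nat k * U)"
proof (induction k)
  case (Suc k)
  from has_neg_log_deriv_mult[OF Suc.prems Suc.IH[OF Suc.prems]]
  show ?case by (simp add: algebra_simps)
qed (simp add: has_neg_log_deriv_1)

lemma has_neg_log_deriv_prod:
  "(\<And>i. i \<in> A \<Longrightarrow> has_neg_log_deriv (f i) (U i)) \<Longrightarrow> has_neg_log_deriv (prod f A) (sum U A)"
  by (induction A rule: infinite_finite_induct)
     (auto intro: has_neg_log_deriv_1 has_neg_log_deriv_mult)

lemma has_neg_log_deriv_prod_list: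
  "(\<And>i. i \<in> set xs \<Longrightarrow> has_neg_log_deriv (f i) (U i)) \<Longrightarrow>
    has_neg_log_deriv (\<Prod>i\<leftarrow>xs. f i) (\<Sum>i\<leftarrow>xs. U i)"
  by (induction xs) (auto intro: has_neg_log_deriv_1 has_neg_log_deriv_mult)

lemma fps_X_mult_deriv_nth: "(fps_X * fps_deriv f) $ n = of_nat n * (f $ n :: complex)"
  by (cases n) auto

text \<open>The source of the power sum: a factor 1 - z t contributes z^n in every positive degree
  n.\<close>

lemma has_neg_log_deriv_linear:
  "has_neg_log_deriv (1 - fps_const z * fps_X) (Abs_fps (\<lambda>n. if n = 0 then 0 else z ^ n))"
proof -
  let ?U = "Abs_fps (\<lambda>n. if n = 0 then 0 else z ^ n)"
  have "of_nat n * (1 - fps_const z * fps_X) $ n = (- ((1 - fps_const z * fps_X) * ?U)) $ n" for n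
  proof -
    have "((1 - fps_const z * fps_X) * ?U) $ n = ?U $ n - (fps_X * (fps_const z * ?U)) $ n"
      by (simp add: algebra_simps)
    also have "\<dots> = (if n = 1 then z else 0)"
      by (cases n rule: nat.exhaust) (auto simp: fps_X_mult_nth power_eq_if)
    finally show ?thesis by (auto simp: fps_X_nth)
  qed
  then show ?thesis unfolding has_neg_log_deriv_def fps_eq_iff fps_X_mult_deriv_nth by blast
qed

text \<open>The source of the divisor sum: a factor of degree \<open>e\<close> contributes
  \<open>e\<close> exactly in the positive multiples of \<open>e\<close>.\<close>

lemma has_neg_log_deriv_one_minus_power:
  assumes "e \<ge> 1"
  shows "has_neg_log_deriv (1 - fps_X ^ e)
    (Abs_fps (\<lambda>n. if n > 0 \<and> e dvd n then of_nat e else 0))"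
proof -
  let ?U = "Abs_fps (\<lambda>n. if n > 0 \<and> e dvd n then of_nat e else 0) :: complex fps"
  have "of_nat n * (1 - fps_X ^ e) $ n = (- ((1 - fps_X ^ e) * ?U)) $ n" for n
  proof -
    have "((1 - fps_X ^ e) * ?U) $ n = ?U $ n - (if n < e then 0 else ?U $ (n - e))"
      by (simp add: left_diff_distrib fps_X_power_mult_nth)
    also have "\<dots> = (if n = e then of_nat e else 0)"
    proof (cases "n < e")
      case True
      then show ?thesis by (auto dest: dvd_imp_le)
    next
      case False
      then have "e dvd n \<longleftrightarrow> e dvd n - e" by (simp add: dvd_minus_self)
      then show ?thesis using False assms by auto
    qed
    finally show ?thesis using assms by auto
  qed
  then show ?thesis unfolding has_neg_log_deriv_def fps_eq_iff fps_X_mult_deriv_nth by blast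
qed

text \<open>A (U - V) equals - t (A - B)' - (A - B) V and so vanishes up to degree \<open>N\<close>;
  the factor t restores the degree lost by differentiating. As \<open>A\<close> has constant term 1,
  it can be cancelled.\<close>

lemma neg_log_deriv_congruence:
  assumes A: "has_neg_log_deriv A U" "A $ 0 = 1" and B: "has_neg_log_deriv B V"
    and dvd: "fps_X ^ Suc N dvd A - B" and n: "n \<le> N"
  shows "U $ n = V $ n"
proof -
  have low: "f $ k = 0" if "fps_X ^ Suc N dvd f" "k \<le> N" for f :: "complex fps" and k
  proof -
    obtain u where u: "f = fps_X ^ Suc N * u" using \<open>fps_X ^ Suc N dvd f\<close> by (elim dvdE)
    show ?thesis unfolding u using that(2) by (subst fps_X_power_mult_nth) simp
  qed
  have AB: "(A - B) $ k = 0" if "k \<le> N" for k using low[OF dvd that] .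
  have "A * (U - V) = (A * U - B * V) - (A - B) * V" by (simp add: algebra_simps)
  also have "A * U - B * V = - (fps_X * fps_deriv (A - B))"
    using A B unfolding has_neg_log_deriv_def by (simp add: algebra_simps)
  finally have *: "A * (U - V) = - (fps_X * fps_deriv (A - B)) - (A - B) * V" .
  have AUV: "(A * (U - V)) $ k = 0" if "k \<le> N" for k
  proof -
    have "((A - B) * V) $ k = 0"
      unfolding fps_mult_nth by (rule sum.neutral) (use AB that in auto)
    then show ?thesis
      unfolding * fps_sub_nth[of "- (fps_X * fps_deriv (A - B))"] fps_neg_nth fps_X_mult_deriv_nth
      using AB[OF that] by simp
  qed
  have "inverse A * A = 1" by (rule inverse_mult_eq_1) (use A in simp)
  then have "U - V = inverse A * (A * (U - V))" by (simp add: mult.assoc[symmetric])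
  also have "\<dots> $ n = 0"
    unfolding fps_mult_nth[of "inverse A"] by (rule sum.neutral) (use AUV n in auto)
  finally show ?thesis by simp
qed

subsection \<open>The characteristic polynomial\<close>

locale free_lie_degrees =
  fixes X :: "'a set" and d :: "'a \<Rightarrow> nat" and \<phi> :: real
  assumes finX: "finite X" and X_nonempty: "X \<noteq> {}" and dpos: "\<forall>x\<in>X. d x \<ge> 1"
    and phi_pos: "\<phi> > 0" and phi_root: "poly (charP X d) (complex_of_real \<phi>) = 0"
begin

abbreviation "P \<equiv> charP X d"
abbreviation "m \<equiv> Max (d ` X)"
abbreviation "g \<equiv> Gcd (d ` X)"

lemma d_le_m: "x \<in> X \<Longrightarrow> d x \<le> m"
  using finX by simp

lemma sum_mult_deg:
  fixes f :: "nat \<Rightarrow> 'b::comm_semiring_1"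
  shows "(\<Sum>q\<in>d ` X. of_nat (mult_deg X d q) * f q) = (\<Sum>x\<in>X. f (d x))"
proof -
  have "(\<Sum>q\<in>d ` X. of_nat (mult_deg X d q) * f q) = (\<Sum>q\<in>d ` X. \<Sum>x\<in>{x\<in>X. d x = q}. f (d x))"
    by (intro sum.cong refl) (simp add: mult_deg_def)
  also have "\<dots> = (\<Sum>x\<in>X. f (d x))" by (rule sum.image_gen[symmetric, OF finX])
  finally show ?thesis .
qed

lemma charP_eq: "P = monom 1 m - (\<Sum>x\<in>X. monom 1 (m - d x))"
proof -
  have "(\<Sum>q\<in>d ` X. monom (of_nat (mult_deg X d q)) (m - q)) =
      (\<Sum>q\<in>d ` X. of_nat (mult_deg X d q) * monom 1 (m - q) :: complex poly)"
    by (simp add: of_nat_poly smult_monom)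
  then show ?thesis unfolding charP_def sum_mult_deg by simp
qed

lemma coeff_P: "coeff P n = (if n = m then 1 else 0) - (\<Sum>x\<in>X. if n = m - d x then 1 else 0)"
  unfolding charP_eq by (simp add: coeff_sum eq_commute)

lemma coeff_P_m: "coeff P m = 1"
proof -
  have "m \<noteq> m - d x" if "x \<in> X" for x using d_le_m[OF that] dpos that by fastforce
  then have "(\<Sum>x\<in>X. if m = m - d x then 1 else 0 :: complex) = 0" by (intro sum.neutral) auto
  then show ?thesis unfolding coeff_P by simp
qed

lemma degree_P: "degree P = m"
proof (rule antisym)
  show "degree P \<le> m"
  proof (rule degree_le, intro allI impI)
    fix i assume "i > m"
    then show "coeff P i = 0" unfolding coeff_P by (auto intro!: sum.neutral)
  qed
  show "m \<le> degree P" using coeff_P_m by (intro le_degree) simp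
qed

lemma P_nonzero: "P \<noteq> 0"
  using coeff_P_m by (metis coeff_0 zero_neq_one)

lemma m_pos: "m > 0"
  using d_le_m dpos X_nonempty by fastforce

lemma g_pos: "g > 0"
  using dpos X_nonempty by (fastforce simp: Gcd_0_iff intro: gr0I)

text \<open>Reversing the coefficients of \<open>P\<close> gives the series of the generators, so
  the factors of that series are 1 - z t with z running through the roots of
  \<open>P\<close>.\<close>

lemma fps_of_reflect_P: "fps_of_poly (reflect_poly P) = 1 - (\<Sum>x\<in>X. fps_X ^ d x)"
proof (rule fps_ext)
  fix n
  have "coeff (reflect_poly P) n = (if n = 0 then 1 else 0) - (\<Sum>x\<in>X. if n = d x then 1 else 0)"
  proof (cases "n > m")
    case True
    then have "n \<noteq> d x" if "x \<in> X" for x using d_le_m[OF that] by simp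
    then have "(\<Sum>x\<in>X. if n = d x then 1 else 0 :: complex) = 0" by (intro sum.neutral) auto
    with True show ?thesis by (simp add: coeff_reflect_poly degree_P)
  next
    case False
    have "(\<Sum>x\<in>X. if m - n = m - d x then 1 else 0) = (\<Sum>x\<in>X. if n = d x then 1 else 0 :: complex)"
      by (intro sum.cong refl) (use False d_le_m in \<open>fastforce\<close>)
    with False m_pos show ?thesis by (auto simp: coeff_reflect_poly degree_P coeff_P)
  qed
  then show "fps_of_poly (reflect_poly P) $ n = (1 - (\<Sum>x\<in>X. fps_X ^ d x)) $ n"
    by (simp add: fps_sum_nth)
qed

section \<open>The roots of the characteristic polynomial and the growth rate\<close>

abbreviation "roots \<equiv> {z. poly P z = 0}"

lemma finite_roots: "finite roots"
  by (rule poly_roots_finite[OF P_nonzero])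

text \<open>The constant coefficient is minus the number of generators of top degree. Hence
  reversing a linear factor loses no degree.\<close>

lemma root_nonzero: "z \<in> roots \<Longrightarrow> z \<noteq> 0"
proof
  assume "z \<in> roots" "z = 0"
  then have "coeff P 0 = 0" by (simp add: poly_0_coeff_0)
  moreover have "coeff P 0 = - of_nat (card {x\<in>X. d x = m})"
  proof -
    have "(\<Sum>x\<in>X. if 0 = m - d x then 1 else 0 :: complex) = (\<Sum>x\<in>X. if d x = m then 1 else 0)"
      by (intro sum.cong refl) (use d_le_m in \<open>auto dest: le_antisym\<close>)
    then show ?thesis using m_pos finX unfolding coeff_P by (simp add: sum.If_cases Int_def)
  qed
  moreover have "m \<in> d ` X" using finX X_nonempty by (intro Max_in) auto
  then have "{x\<in>X. d x = m} \<noteq> {}" by force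
  then have "card {x\<in>X. d x = m} \<noteq> 0" using finX by simp
  ultimately show False by simp
qed

lemma sum_order_roots: "(\<Sum>z\<in>roots. order z P) = m"
proof -
  have "size (proots P) = m" by (simp add: size_proots_complex degree_P)
  then show ?thesis by (simp add: size_multiset_overloaded_eq P_nonzero)
qed

lemma has_neg_log_deriv_P:
  "has_neg_log_deriv (1 - (\<Sum>x\<in>X. fps_X ^ d x))
    (\<Sum>z\<in>roots. of_nat (order z P) * Abs_fps (\<lambda>n. if n = 0 then 0 else z ^ n))"
proof -
  have "P = (\<Prod>z\<in>roots. [:- z, 1:] ^ order z P)"
    using complex_poly_decompose[of P] coeff_P_m by (simp add: degree_P)
  then have "fps_of_poly (reflect_poly P) =
      fps_of_poly (reflect_poly (\<Prod>z\<in>roots. [:- z, 1:] ^ order z P))" by simp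
  also have "\<dots> = (\<Prod>z\<in>roots. (1 - fps_const z * fps_X) ^ order z P)"
    unfolding reflect_poly_prod reflect_poly_power fps_of_poly_prod fps_of_poly_power
  proof (intro prod.cong refl arg_cong[where f = "\<lambda>u. u ^ _"])
    fix z assume "z \<in> roots"
    then have "reflect_poly [:- z, 1:] = [:1, - z:]"
      using root_nonzero[of z] by (simp add: reflect_poly_pCons)
    then show "fps_of_poly (reflect_poly [:- z, 1:]) = 1 - fps_const z * fps_X"
      by (simp add: fps_of_poly_pCons fps_const_neg[symmetric] del: fps_const_neg)
  qed
  finally show ?thesis unfolding fps_of_reflect_P
    by (simp only:) (intro has_neg_log_deriv_prod has_neg_log_deriv_power has_neg_log_deriv_linear)
qed

lemma divisor_sum_eq_power_sum:
  assumes ds: "\<forall>e\<in>set ds. e \<ge> 1"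
    and dvd: "fps_X ^ Suc N dvd (\<Prod>e\<leftarrow>ds. 1 - fps_X ^ e) - (1 - (\<Sum>x\<in>X. fps_X ^ d x) :: complex fps)"
    and "N > 0"
  shows "of_nat (\<Sum>e\<leftarrow>ds. if e dvd N then e else 0) = (\<Sum>z\<in>roots. of_nat (order z P) * z ^ N)"
proof -
  let ?U = "\<lambda>e. Abs_fps (\<lambda>n. if n > 0 \<and> e dvd n then of_nat e else 0) :: complex fps"
  have A: "has_neg_log_deriv (\<Prod>e\<leftarrow>ds. 1 - fps_X ^ e) (\<Sum>e\<leftarrow>ds. ?U e)"
    using ds by (intro has_neg_log_deriv_prod_list has_neg_log_deriv_one_minus_power) auto
  have A0: "(\<Prod>e\<leftarrow>ds. 1 - fps_X ^ e) $ 0 = (1 :: complex)"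
    using ds by (induction ds) auto
  have "(\<Sum>e\<leftarrow>ds. ?U e) $ N = (of_nat (\<Sum>e\<leftarrow>ds. if e dvd N then e else 0) :: complex)"
    using \<open>N > 0\<close> by (induction ds) auto
  moreover have "(\<Sum>z\<in>roots. of_nat (order z P) * Abs_fps (\<lambda>n. if n = 0 then 0 else z ^ n)) $ N =
      (\<Sum>z\<in>roots. of_nat (order z P) * z ^ N)"
    using \<open>N > 0\<close> by (simp add: fps_sum_nth fps_of_nat[symmetric] del: fps_of_nat)
  ultimately show ?thesis
    using neg_log_deriv_congruence[OF A A0 has_neg_log_deriv_P dvd order_refl] by simp
qed

text \<open>Division by z^m puts the root equation into a form in which the moduli of z and \<phi>
  can be compared term by term.\<close>

lemma root_iff: "z \<in> roots \<longleftrightarrow> z \<noteq> 0 \<and> (\<Sum>x\<in>X. (1 / z) ^ d x) = 1"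
proof (cases "z = 0")
  case True
  then show ?thesis using root_nonzero by blast
next
  case False
  have "poly P z = z ^ m - (\<Sum>x\<in>X. z ^ (m - d x))"
    by (simp add: charP_eq poly_sum poly_monom)
  also have "(\<Sum>x\<in>X. z ^ (m - d x)) = z ^ m * (\<Sum>x\<in>X. (1 / z) ^ d x)"
    unfolding sum_distrib_left
    by (intro sum.cong refl) (use False d_le_m in \<open>simp add: power_diff field_simps\<close>)
  finally have "poly P z = z ^ m * (1 - (\<Sum>x\<in>X. (1 / z) ^ d x))" by (simp add: algebra_simps)
  with False show ?thesis by auto
qed

lemma phi_sum: "(\<Sum>x\<in>X. (1 / \<phi>) ^ d x) = 1"
proof -
  have "complex_of_real (\<Sum>x\<in>X. (1 / \<phi>) ^ d x) = 1"
    using root_iff[of "of_real \<phi>"] phi_root by simp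
  then show ?thesis by (simp only: of_real_eq_1_iff)
qed

lemma phi_ge_1: "\<phi> \<ge> 1"
proof (rule ccontr)
  assume "\<not> \<phi> \<ge> 1"
  obtain x where x: "x \<in> X" using X_nonempty by blast
  have "1 < (1 / \<phi>) ^ d x"
    using \<open>\<not> \<phi> \<ge> 1\<close> phi_pos dpos x by (intro one_less_power) auto
  also have "\<dots> \<le> (\<Sum>x\<in>X. (1 / \<phi>) ^ d x)"
    using phi_pos by (intro member_le_sum[OF x _ finX]) auto
  finally show False using phi_sum by simp
qed

lemma power_eq_1_Gcd:
  fixes \<zeta> :: complex
  assumes "finite A" "\<And>n. n \<in> A \<Longrightarrow> \<zeta> ^ n = 1"
  shows "\<zeta> ^ Gcd A = 1"
  using assms
proof (induction A rule: finite_induct)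
  case (insert a A)
  then have a: "\<zeta> ^ a = 1" and b: "\<zeta> ^ Gcd A = 1" by auto
  show ?case
  proof (cases "a = 0")
    case False
    then obtain x y where xy: "a * x = Gcd A * y + gcd a (Gcd A)" using bezout_nat by blast
    have "1 = \<zeta> ^ (a * x)" by (simp add: power_mult a)
    also have "\<dots> = \<zeta> ^ gcd a (Gcd A)" unfolding xy by (simp add: power_add power_mult b)
    finally show ?thesis by simp
  qed (use b in simp)
qed simp

lemma complex_of_real_Re_if_norm_eq: "cmod z = Re z \<Longrightarrow> z = of_real (Re z)"
  using cmod_power2[of z] by (simp add: complex_eq_iff)

text \<open>The equality case of the triangle inequality. If |z| is at least \<phi>, the real part
  of each (1/z)^d is at most (1/\<phi>)^d, yet both sums are 1. So every term is that positive real
  number, each degree d satisfies (z/\<phi>)^d = 1, and Bezout passes to \<open>g\<close>. In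
  particular no root lies outside the circle of radius \<phi>.\<close>

lemma peripheral_roots: "{z\<in>roots. cmod z \<ge> \<phi>} = {z. z ^ g = complex_of_real \<phi> ^ g}"
proof (intro subset_antisym subsetI)
  fix z assume "z \<in> {z\<in>roots. cmod z \<ge> \<phi>}"
  then have z: "z \<noteq> 0" "(\<Sum>x\<in>X. (1 / z) ^ d x) = 1" "cmod z \<ge> \<phi>" using root_iff by auto
  have norm_le: "cmod ((1 / z) ^ d x) \<le> (1 / \<phi>) ^ d x" for x
    using z(1,3) phi_pos by (auto simp: norm_power norm_divide intro!: power_mono divide_left_mono)
  have "Re (\<Sum>x\<in>X. (1 / z) ^ d x) = (\<Sum>x\<in>X. (1 / \<phi>) ^ d x)" unfolding z(2) phi_sum by simp
  then have sum: "(\<Sum>x\<in>X. Re ((1 / z) ^ d x)) = (\<Sum>x\<in>X. (1 / \<phi>) ^ d x)" by (simp only: Re_sum)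
  have "(z / of_real \<phi>) ^ d x = 1" if x: "x \<in> X" for x
  proof -
    have le: "Re ((1 / z) ^ d x) \<le> (1 / \<phi>) ^ d x" for x
      using complex_Re_le_cmod norm_le by (rule order_trans)
    have Re: "Re ((1 / z) ^ d x) = (1 / \<phi>) ^ d x"
      using sum_mono_inv[OF sum le x finX] .
    have "cmod ((1 / z) ^ d x) = Re ((1 / z) ^ d x)"
      using norm_le[of x] complex_Re_le_cmod[of "(1 / z) ^ d x"] unfolding Re by linarith
    then have "(1 / z) ^ d x = of_real (Re ((1 / z) ^ d x))"
      by (rule complex_of_real_Re_if_norm_eq)
    also have "\<dots> = (1 / of_real \<phi>) ^ d x" by (simp only: Re) simp
    finally have "(of_real \<phi> * (1 / z)) ^ d x = (of_real \<phi> * (1 / of_real \<phi>)) ^ d x"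
      by (simp only: power_mult_distrib)
    then have inv: "(of_real \<phi> / z) ^ d x = 1" using phi_pos by simp
    have "(z / of_real \<phi>) ^ d x = inverse ((of_real \<phi> / z) ^ d x)"
      unfolding power_inverse[symmetric] by simp
    then show ?thesis unfolding inv by simp
  qed
  then have "(z / of_real \<phi>) ^ g = 1" using finX by (intro power_eq_1_Gcd) auto
  then show "z \<in> {z. z ^ g = complex_of_real \<phi> ^ g}" using phi_pos by (simp add: power_divide)
next
  fix z assume "z \<in> {z. z ^ g = complex_of_real \<phi> ^ g}"
  then have z: "z ^ g = of_real \<phi> ^ g" by simp
  have "cmod z ^ g = cmod (z ^ g)" by (rule norm_power[symmetric])
  also have "\<dots> = \<phi> ^ g" unfolding z using phi_pos by (simp only: norm_power norm_of_real abs_of_pos)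
  finally have norm: "cmod z = \<phi>"
    by (rule power_eq_imp_eq_base) (use phi_pos g_pos in simp_all)
  have "z ^ d x = of_real \<phi> ^ d x" if "x \<in> X" for x
  proof -
    have "g dvd d x" using that by simp
    then obtain k where k: "d x = g * k" by (elim dvdE)
    show ?thesis unfolding k power_mult z ..
  qed
  then have "(\<Sum>x\<in>X. (1 / z) ^ d x) = (\<Sum>x\<in>X. (1 / complex_of_real \<phi>) ^ d x)"
    by (simp add: power_divide)
  also have "\<dots> = 1" using root_iff phi_root by blast
  finally show "z \<in> {z\<in>roots. cmod z \<ge> \<phi>}" using norm phi_pos root_iff[of z] by auto
qed

lemma pderiv_sum: "pderiv (sum f A) = (\<Sum>i\<in>A. pderiv (f i))"
  by (induction A rule: infinite_finite_induct) (auto simp: pderiv_add)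

text \<open>On the circle z^d = \<phi>^d for every generator degree d, so z P'(z) is z^m times the
  sum of the d / \<phi>^d, a sum of positive terms.\<close>

lemma order_peripheral_root:
  assumes "z \<in> roots" "cmod z \<ge> \<phi>"
  shows "order z P = 1"
proof -
  have z: "z ^ g = complex_of_real \<phi> ^ g" using peripheral_roots assms by blast
  have z0: "z \<noteq> 0" using assms root_nonzero by blast
  have zd: "z ^ d x = of_real \<phi> ^ d x" if "x \<in> X" for x
  proof -
    have "g dvd d x" using that by simp
    then obtain k where k: "d x = g * k" by (elim dvdE)
    show ?thesis unfolding k power_mult z ..
  qed
  have shift: "z * (of_nat k * z ^ (k - 1)) = of_nat k * z ^ k" for k
    by (cases k) auto
  have "poly (pderiv P) z =
      of_nat m * z ^ (m - 1) - (\<Sum>x\<in>X. of_nat (m - d x) * z ^ (m - d x - 1))"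
    unfolding charP_eq
    by (simp add: pderiv_diff pderiv_sum pderiv_monom poly_sum poly_monom del: One_nat_def)
  then have "z * poly (pderiv P) z = of_nat m * z ^ m - (\<Sum>x\<in>X. of_nat (m - d x) * z ^ (m - d x))"
    by (simp only: right_diff_distrib sum_distrib_left shift)
  also have "\<dots> = of_nat m * poly P z + (\<Sum>x\<in>X. of_nat (d x) * z ^ (m - d x))"
  proof -
    have "of_nat (m - d x) * z ^ (m - d x) =
        of_nat m * z ^ (m - d x) - of_nat (d x) * z ^ (m - d x)" if "x \<in> X" for x
      using d_le_m[OF that] by (simp add: of_nat_diff algebra_simps)
    then show ?thesis
      by (simp add: charP_eq poly_sum poly_monom right_diff_distrib sum_distrib_left sum_subtractf)
  qed
  also have "\<dots> = (\<Sum>x\<in>X. of_nat (d x) * (z ^ m / of_real \<phi> ^ d x))"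
    using assms z0 d_le_m zd by (simp add: power_diff)
  also have "\<dots> = z ^ m * complex_of_real (\<Sum>x\<in>X. of_nat (d x) / \<phi> ^ d x)"
    by (simp add: sum_distrib_left mult.commute)
  finally have "z * poly (pderiv P) z = z ^ m * complex_of_real (\<Sum>x\<in>X. of_nat (d x) / \<phi> ^ d x)" .
  moreover have "(\<Sum>x\<in>X. of_nat (d x) / \<phi> ^ d x) > 0"
    using dpos phi_pos finX X_nonempty by (intro sum_pos) (auto simp: Suc_le_eq)
  ultimately have "poly (pderiv P) z \<noteq> 0" using z0
    by (metis mult_eq_0_iff of_real_eq_0_iff order_less_irrefl power_not_zero)
  then have "order z (pderiv P) = 0" by (rule order_0I)
  then show ?thesis using order_pderiv[OF P_nonzero] assms by simp
qed

text \<open>The \<open>g\<close> dominant roots are simple and each contributes \<phi>^N because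
  \<open>g\<close> divides \<open>N\<close>. The others are bounded by \<open>r\<close>, with total
  multiplicity at most \<open>m\<close>.\<close>

lemma power_sum_estimate:
  assumes "g dvd N" and psi: "\<forall>z\<in>roots. cmod z < \<phi> \<longrightarrow> cmod z \<le> r" and "r \<ge> 0"
  shows "cmod ((\<Sum>z\<in>roots. of_nat (order z P) * z ^ N) - of_real (real g * \<phi> ^ N)) \<le> real m * r ^ N"
    and "{z\<in>roots. cmod z < \<phi>} = {} \<Longrightarrow>
      (\<Sum>z\<in>roots. of_nat (order z P) * z ^ N) = of_real (real g * \<phi> ^ N)"
proof -
  let ?R = "{z\<in>roots. cmod z \<ge> \<phi>}" and ?S = "{z\<in>roots. cmod z < \<phi>}"
  have split: "roots = ?R \<union> ?S" "?R \<inter> ?S = {}" by auto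
  have fin: "finite ?R" "finite ?S" using finite_roots by auto
  have card_R: "card ?R = g" unfolding peripheral_roots
    using phi_pos g_pos by (intro card_nth_roots) auto
  have "(\<Sum>z\<in>?R. of_nat (order z P) * z ^ N) = (\<Sum>z\<in>?R. of_real (\<phi> ^ N))"
  proof (rule sum.cong[OF refl])
    fix z assume z: "z \<in> ?R"
    then have "z ^ g = of_real \<phi> ^ g" using peripheral_roots by blast
    moreover obtain k where "N = g * k" using \<open>g dvd N\<close> by (elim dvdE)
    ultimately have "z ^ N = of_real (\<phi> ^ N)" by (simp add: power_mult)
    then show "of_nat (order z P) * z ^ N = of_real (\<phi> ^ N)" using order_peripheral_root z by simp
  qed
  then have R: "(\<Sum>z\<in>?R. of_nat (order z P) * z ^ N) = of_real (real g * \<phi> ^ N)"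
    using card_R by simp
  have "(\<Sum>z\<in>roots. of_nat (order z P) * z ^ N) =
      (\<Sum>z\<in>?R. of_nat (order z P) * z ^ N) + (\<Sum>z\<in>?S. of_nat (order z P) * z ^ N)"
    by (subst split(1), rule sum.union_disjoint[OF fin split(2)])
  then have eq: "(\<Sum>z\<in>roots. of_nat (order z P) * z ^ N) =
      of_real (real g * \<phi> ^ N) + (\<Sum>z\<in>?S. of_nat (order z P) * z ^ N)"
    unfolding R .
  have "cmod (\<Sum>z\<in>?S. of_nat (order z P) * z ^ N) \<le> (\<Sum>z\<in>?S. real (order z P) * r ^ N)"
    using psi by (intro sum_norm_le) (auto simp: norm_mult norm_power intro!: mult_left_mono power_mono)
  also have "\<dots> \<le> (\<Sum>z\<in>roots. real (order z P) * r ^ N)"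
    using finite_roots \<open>r \<ge> 0\<close> by (intro sum_mono2) auto
  also have "\<dots> = real m * r ^ N"
    unfolding sum_distrib_right[symmetric] sum_order_roots[symmetric] by simp
  finally show "cmod ((\<Sum>z\<in>roots. of_nat (order z P) * z ^ N) - of_real (real g * \<phi> ^ N)) \<le> real m * r ^ N"
    unfolding eq by simp
  show "(\<Sum>z\<in>roots. of_nat (order z P) * z ^ N) = of_real (real g * \<phi> ^ N)" if "?S = {}"
    unfolding eq that by simp
qed

text \<open>Since the (1/\<phi>)^d over all generators sum to 1, the recursion on the first letter
  preserves the bound with constant 1.\<close>

lemma card_words_le: "real (card (words X d n)) \<le> \<phi> ^ n"
proof (induction n rule: less_induct)
  case (less n)
  show ?case
  proof (cases "n = 0")
    case False
    then have "real (card (words X d n)) = (\<Sum>x\<in>{x\<in>X. d x \<le> n}. real (card (words X d (n - d x))))"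
      by (simp add: card_words_pos[OF finX dpos])
    also have "\<dots> \<le> (\<Sum>x\<in>{x\<in>X. d x \<le> n}. \<phi> ^ n * (1 / \<phi>) ^ d x)"
    proof (rule sum_mono)
      fix x assume x: "x \<in> {x\<in>X. d x \<le> n}"
      then have "real (card (words X d (n - d x))) \<le> \<phi> ^ (n - d x)"
        using dpos False by (intro less.IH) auto
      also have "\<dots> = \<phi> ^ n * (1 / \<phi>) ^ d x" using x phi_pos by (simp add: power_diff power_divide)
      finally show "real (card (words X d (n - d x))) \<le> \<phi> ^ n * (1 / \<phi>) ^ d x" .
    qed
    also have "\<dots> \<le> (\<Sum>x\<in>X. \<phi> ^ n * (1 / \<phi>) ^ d x)"
      using finX phi_pos by (intro sum_mono2) auto
    also have "\<dots> = \<phi> ^ n" by (simp only: sum_distrib_left[symmetric] phi_sum mult_1_right)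
    finally show ?thesis .
  qed (simp add: words_0[OF dpos])
qed

lemma words_empty:
  assumes "\<not> g dvd N"
  shows "words X d N = {}"
proof -
  have "g dvd wdeg d w" if "w \<in> lists X" for w
    using that by (induction w) auto
  with assms show ?thesis by (auto simp: words_def)
qed

text \<open>As \<phi> is at least 1, replacing each degree by the largest one only shrinks the terms
  (1/\<phi>)^d, which sum to 1.\<close>

lemma phi_lower_bound: "real (\<Sum>q\<in>d ` X. mult_deg X d q) powr (1 / real m) \<le> \<phi>"
proof -
  have card: "(\<Sum>q\<in>d ` X. mult_deg X d q) = card X"
    using sum_mult_deg[of "\<lambda>_. 1 :: nat"] by simp
  have "real (card X) / \<phi> ^ m = (\<Sum>x\<in>X. (1 / \<phi>) ^ m)" by (simp add: power_divide)
  also have "\<dots> \<le> (\<Sum>x\<in>X. (1 / \<phi>) ^ d x)"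
    using phi_ge_1 d_le_m by (intro sum_mono power_decreasing) auto
  also have "\<dots> = 1" by (rule phi_sum)
  finally have "real (card X) \<le> \<phi> ^ m" using phi_pos by (simp add: field_simps)
  then have "real (card X) powr (1 / real m) \<le> (\<phi> ^ m) powr (1 / real m)"
    by (intro powr_mono2) auto
  also have "\<dots> = \<phi>" using phi_pos m_pos by (simp add: powr_realpow[symmetric] powr_powr)
  finally show ?thesis unfolding card .
qed

end

subsection \<open>The contribution of the proper divisors\<close>

text \<open>The exponent vector of the monomial \<open>h_i^(k-1) h_j\<close> in \<open>n\<close> variables.\<close>

definition pair_exponents :: "nat \<Rightarrow> nat \<Rightarrow> nat \<Rightarrow> nat \<Rightarrow> nat list" where
  "pair_exponents n k i j =
     map (\<lambda>l. (if l = i then k - 1 else 0) + (if l = j then 1 else 0)) [0..<n]"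

lemma pair_exponents_nth:
  "l < n \<Longrightarrow> pair_exponents n k i j ! l = (if l = i then k - 1 else 0) + (if l = j then 1 else 0)"
  by (simp add: pair_exponents_def)

lemma pair_exponents_in_exponents:
  assumes "i < length ds" "j < length ds" "k * ds ! i = N" "k * ds ! j = N" "k \<ge> 1"
    and "N > 0"
  shows "pair_exponents (length ds) k i j \<in> exponents ds N"
proof -
  have "sum_list (map2 (*) (pair_exponents (length ds) k i j) ds) =
      (\<Sum>l<length ds. pair_exponents (length ds) k i j ! l * ds ! l)"
    by (simp add: sum_list_sum_nth pair_exponents_def atLeast0LessThan)
  also have "\<dots> = (\<Sum>l<length ds. (if l = i then (k - 1) * ds ! i else 0) + (if l = j then ds ! j else 0))"
    by (intro sum.cong) (auto simp: pair_exponents_nth algebra_simps)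
  also have "\<dots> = (k - 1) * ds ! i + ds ! j"
    using assms by (simp add: sum.distrib)
  also have "ds ! j = ds ! i"
  proof -
    have "k * ds ! j = k * ds ! i" using assms by simp
    then show ?thesis using assms(5) by simp
  qed
  also have "(k - 1) * ds ! i + ds ! i = N" using assms by (simp add: mult_eq_if)
  finally show ?thesis by (simp add: exponents_def pair_exponents_def)
qed

lemma sum_list_pair_exponents:
  assumes "i < n" "j < n" "k \<ge> 1"
  shows "sum_list (pair_exponents n k i j) = k"
proof -
  have "sum_list (pair_exponents n k i j) =
      (\<Sum>l<n. (if l = i then k - 1 else 0) + (if l = j then 1 else 0))"
    by (simp add: pair_exponents_def interv_sum_list_conv_sum_set_nat atLeast0LessThan)
  then show ?thesis using assms by (simp add: sum.distrib)
qed

text \<open>The entries add up to \<open>k\<close>. For \<open>k\<close> at least 3,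
  \<open>i\<close> is the only place with an entry of at least 2, and then \<open>j\<close> is
  determined. For \<open>k = 2\<close> the vector is symmetric in \<open>i\<close> and
  \<open>j\<close>, whence the ordering condition.\<close>

lemma pair_exponents_inj:
  assumes eq: "pair_exponents n k i j = pair_exponents n k' i' j'"
    and less: "i < n" "j < n" "i' < n" "j' < n" and k: "k \<ge> 2" "k' \<ge> 2"
    and le: "k = 2 \<longrightarrow> i \<le> j" "k' = 2 \<longrightarrow> i' \<le> j'"
  shows "k = k' \<and> i = i' \<and> j = j'"
proof -
  have kk: "k = k'"
    using sum_list_pair_exponents[of i n j k] sum_list_pair_exponents[of i' n j' k'] eq less k by simp
  have nth: "(if l = i then k - 1 else 0) + (if l = j then 1 else 0) =
      (if l = i' then k - 1 else 0) + (if l = j' then 1 else 0)" if "l < n" for l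
    using pair_exponents_nth[OF that] eq kk by metis
  show ?thesis
  proof (cases "k = 2")
    case True
    then show ?thesis using nth[OF less(1)] nth[OF less(2)] nth[OF less(3)] nth[OF less(4)] le kk
      by (auto split: if_splits)
  next
    case False
    then have "k \<ge> 3" using k by simp
    then have "i = i'" using nth[OF less(1)] by (auto split: if_splits)
    moreover from this have "j = j'" using nth[OF less(2)] by (auto split: if_splits)
    ultimately show ?thesis using kk by simp
  qed
qed

text \<open>Indices of degree \<open>N / k\<close>; in product form the set is empty for positive
  \<open>N\<close> unless \<open>k\<close> divides \<open>N\<close>.\<close>

definition index_quotient :: "nat list \<Rightarrow> nat \<Rightarrow> nat \<Rightarrow> nat set" where
  "index_quotient ds N k = {i. i < length ds \<and> k * ds ! i = N}"

lemma finite_index_quotient [simp]: "finite (index_quotient ds N k)"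
  by (simp add: index_quotient_def)

lemma card_le_pairs:
  fixes A :: "nat set"
  assumes "finite A"
  shows "(card A)\<^sup>2 \<le> 2 * card {(i, j). i \<in> A \<and> j \<in> A \<and> i \<le> j}"
proof -
  let ?B = "{(i, j). i \<in> A \<and> j \<in> A \<and> i \<le> j}"
  have fin: "finite ?B" by (rule finite_subset[of _ "A \<times> A"]) (use assms in auto)
  have "(card A)\<^sup>2 = card (A \<times> A)" by (simp add: card_cartesian_product power2_eq_square)
  also have "\<dots> \<le> card (?B \<union> prod.swap ` ?B)"
  proof (rule card_mono)
    show "A \<times> A \<subseteq> ?B \<union> prod.swap ` ?B"
    proof
      fix p assume "p \<in> A \<times> A"
      then show "p \<in> ?B \<union> prod.swap ` ?B"
        by (cases p; cases "fst p \<le> snd p") (auto intro!: image_eqI[of _ _ "prod.swap p"])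
    qed
  qed (use fin in simp)
  also have "\<dots> \<le> card ?B + card (prod.swap ` ?B)" by (rule card_Un_le)
  also have "\<dots> \<le> 2 * card ?B" using card_image_le[OF fin, of prod.swap] by simp
  finally show ?thesis .
qed

text \<open>Triples (k, i, j) inject into the exponent vectors of degree \<open>N\<close>. At
  \<open>k = 2\<close> only pairs with i at most j are used, at least half of all, which explains
  the denominator 2.\<close>

lemma sum_squares_le_card_exponents:
  assumes ds: "\<forall>e\<in>set ds. e \<ge> 1" and "N > 0"
  shows "(\<Sum>k=2..N. (real (card (index_quotient ds N k)))\<^sup>2 / (if k = 2 then 2 else 1))
    \<le> real (card (exponents ds N))"
proof -
  let ?A = "index_quotient ds N"
  define B where "B k = {(i, j). i \<in> ?A k \<and> j \<in> ?A k \<and> (k = 2 \<longrightarrow> i \<le> j)}" for k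
  have fin: "finite (B k)" for k
    by (rule finite_subset[of _ "?A k \<times> ?A k"]) (auto simp: B_def)
  have "(real (card (?A k)))\<^sup>2 / (if k = 2 then 2 else 1) \<le> real (card (B k))" for k
  proof (cases "k = 2")
    case True
    have "(card (?A k))\<^sup>2 \<le> 2 * card (B k)"
      using card_le_pairs[of "?A k"] True by (simp add: B_def)
    then have "(real (card (?A k)))\<^sup>2 \<le> 2 * real (card (B k))"
      by (metis of_nat_le_iff of_nat_mult of_nat_numeral of_nat_power)
    then show ?thesis using True by simp
  next
    case False
    then have "B k = ?A k \<times> ?A k" by (auto simp: B_def)
    then show ?thesis using False by (simp add: card_cartesian_product power2_eq_square)
  qed
  then have "(\<Sum>k=2..N. (real (card (?A k)))\<^sup>2 / (if k = 2 then 2 else 1)) \<le>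
      (\<Sum>k=2..N. real (card (B k)))" by (rule sum_mono)
  also have "\<dots> = real (card (Sigma {2..N} B))" using fin by (simp add: card_SigmaI)
  also have "card (Sigma {2..N} B) \<le> card (exponents ds N)"
  proof (rule card_inj_on_le)
    let ?f = "\<lambda>(k, i, j). pair_exponents (length ds) k i j"
    show "inj_on ?f (Sigma {2..N} B)"
    proof (rule inj_onI)
      fix p q assume p: "p \<in> Sigma {2..N} B" and q: "q \<in> Sigma {2..N} B" and eq: "?f p = ?f q"
      obtain k i j k' i' j' where pq: "p = (k, i, j)" "q = (k', i', j')"
        by (metis prod_cases3)
      show "p = q"
        using pair_exponents_inj[of "length ds" k i j k' i' j'] p q eq
        unfolding pq by (auto simp: B_def index_quotient_def)
    qed
    show "?f ` Sigma {2..N} B \<subseteq> exponents ds N"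
      using \<open>N > 0\<close> by (auto simp: B_def index_quotient_def intro!: pair_exponents_in_exponents)
  qed (rule finite_exponents[OF ds])
  finally show ?thesis by simp
qed

lemma sum_inverse_squares_le: "(\<Sum>k=2..N. (if k = 2 then 2 else 1) / (real k)\<^sup>2) \<le> 1"
proof (cases "N \<ge> 2")
  case True
  \<comment> \<open>The strengthened bound telescopes, and at \<open>N = 2\<close> it is an
    equality: 2/4 = 1 - 1/2.\<close>
  have "(\<Sum>k=2..N. (if k = 2 then 2 else 1) / (real k)\<^sup>2) \<le> 1 - 1 / real N"
    using True
  proof (induction N rule: dec_induct)
    case base
    show ?case by simp
  next
    case (step n)
    have "1 / (real (Suc n))\<^sup>2 \<le> 1 / real n - 1 / real (Suc n)"
    proof -
      have n: "real n > 0" using step.hyps by simp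
      have "1 / (real (Suc n))\<^sup>2 \<le> 1 / (real n * real (Suc n))"
        using n by (intro divide_left_mono) (auto simp: power2_eq_square)
      also have "\<dots> = 1 / real n - 1 / real (Suc n)" using n by (simp add: field_simps)
      finally show ?thesis .
    qed
    then show ?case using step by simp
  qed
  then show ?thesis by (smt (verit) divide_nonneg_nonneg of_nat_0_le_iff)
qed simp

text \<open>If \<open>k * e = N\<close>, then e / N = 1 / k, and \<open>e\<close> differs from
  \<open>N\<close> exactly when \<open>k\<close> is at least 2; it remains to group the entries by
  \<open>k\<close>.\<close>

lemma proper_divisor_sum_eq:
  assumes ds: "\<forall>e\<in>set ds. e \<ge> 1" and "N > 0"
  shows "real (\<Sum>e\<leftarrow>ds. if e dvd N \<and> e \<noteq> N then e else 0) / real N =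
    (\<Sum>k=2..N. real (card (index_quotient ds N k)) / real k)"
proof -
  have inner: "(\<Sum>k=2..N. if k * e = N then 1 / real k else 0) =
      (if e dvd N \<and> e \<noteq> N then real e / real N else 0)" if "e \<ge> 1" for e
  proof (cases "e dvd N")
    case True
    then obtain c where c: "N = e * c" by (elim dvdE)
    have "c \<le> N" using c that by simp
    have "(\<Sum>k=2..N. if k * e = N then 1 / real k else 0) = (\<Sum>k=2..N. if k = c then 1 / real c else 0)"
      by (intro sum.cong) (use that c in auto)
    also have "\<dots> = (if c \<in> {2..N} then 1 / real c else 0)" by simp
    also have "c \<in> {2..N} \<longleftrightarrow> e \<noteq> N"
      using c that \<open>N > 0\<close> \<open>c \<le> N\<close> by (cases c rule: nat.exhaust) (auto simp: Suc_le_eq)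
    also have "1 / real c = real e / real N" using c that by simp
    finally show ?thesis using True by simp
  next
    case False
    then have "\<not> (\<exists>k. k * e = N)" by auto
    with False show ?thesis by simp
  qed
  have "real (\<Sum>e\<leftarrow>ds. if e dvd N \<and> e \<noteq> N then e else 0) / real N =
      (\<Sum>i<length ds. if ds ! i dvd N \<and> ds ! i \<noteq> N then real (ds ! i) / real N else 0)"
    by (auto simp: sum_list_sum_nth atLeast0LessThan sum_divide_distrib intro!: sum.cong)
  also have "\<dots> = (\<Sum>i<length ds. \<Sum>k=2..N. if k * ds ! i = N then 1 / real k else 0)"
    by (intro sum.cong refl inner[symmetric]) (use ds in auto)
  also have "\<dots> = (\<Sum>k=2..N. \<Sum>i<length ds. if k * ds ! i = N then 1 / real k else 0)"
    by (rule sum.swap)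
  also have "\<dots> = (\<Sum>k=2..N. real (card (index_quotient ds N k)) / real k)"
    by (intro sum.cong refl)
       (simp add: sum.If_cases index_quotient_def lessThan_def Collect_conj_eq[symmetric])
  finally show ?thesis .
qed

text \<open>By the Cauchy-Schwarz inequality with weights \<open>2, 1, 1, \<dots>\<close> at \<open>k = 2, 3, 4, \<dots>\<close>.\<close>

lemma proper_divisor_sum_le:
  assumes ds: "\<forall>e\<in>set ds. e \<ge> 1" and "N > 0"
  shows "(real (\<Sum>e\<leftarrow>ds. if e dvd N \<and> e \<noteq> N then e else 0) / real N)\<^sup>2 \<le> real (card (exponents ds N))"
proof -
  let ?a = "\<lambda>k. real (card (index_quotient ds N k))"
  let ?s = "\<lambda>k :: nat. if k = 2 then 2 else 1 :: real"
  have "(\<Sum>k=2..N. ?a k / real k) = (\<Sum>k=2..N. ?a k / sqrt (?s k) * (sqrt (?s k) / real k))"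
    by (intro sum.cong) auto
  then have "(\<Sum>k=2..N. ?a k / real k)\<^sup>2 \<le>
      (\<Sum>k=2..N. (?a k / sqrt (?s k))\<^sup>2) * (\<Sum>k=2..N. (sqrt (?s k) / real k)\<^sup>2)"
    using Cauchy_Schwarz_ineq_sum[of "\<lambda>k. ?a k / sqrt (?s k)" "\<lambda>k. sqrt (?s k) / real k"] by simp
  also have "\<dots> = (\<Sum>k=2..N. (?a k)\<^sup>2 / ?s k) * (\<Sum>k=2..N. ?s k / (real k)\<^sup>2)"
    by (intro arg_cong2[where f = "(*)"] sum.cong) (auto simp: power_divide)
  also have "\<dots> \<le> real (card (exponents ds N)) * 1"
    by (intro mult_mono sum_squares_le_card_exponents sum_inverse_squares_le ds \<open>N > 0\<close> sum_nonneg) auto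
  finally show ?thesis unfolding proper_divisor_sum_eq[OF ds \<open>N > 0\<close>] by simp
qed

subsection \<open>The rank formula\<close>

context free_lie_degrees
begin

lemma zrank_eq_0:
  assumes "\<not> g dvd N"
  shows "zrank (lie_comp X d N) = 0"
proof -
  obtain ds where ds: "\<forall>e\<in>set ds. e \<ge> 1"
    "fps_X ^ Suc N dvd (\<Prod>e\<leftarrow>ds. 1 - fps_X ^ e) - (1 - (\<Sum>x\<in>X. fps_X ^ d x) :: complex fps)"
    "card (exponents ds N) = card (words X d N)"
    "zrank (lie_comp X d N) = card {i. i < length ds \<and> ds ! i = N}"
    by (rule zrank_lie_comp[OF finX dpos])
  \<comment> \<open>Without words of degree \<open>N\<close> there are no exponent vectors of that
    degree, in particular no unit vectors.\<close>
  have "exponents ds N = {}"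
    using ds(3) finite_exponents[OF ds(1)] words_empty[OF assms] by simp
  moreover have "(replicate (length ds) 0)[i := 1] \<in> exponents ds N" if "i < length ds" "ds ! i = N" for i
    using that by (simp add: exponents_def weighted_sum_unit)
  ultimately have "{i. i < length ds \<and> ds ! i = N} = {}" by blast
  then show ?thesis using ds(4) by simp
qed

text \<open>The entries of \<open>ds\<close> equal to \<open>N\<close> contribute \<open>N\<close>
  times the rank and the proper divisors contribute \<open>T\<close>. Hence the power sum is
  \<open>N * r + T\<close>, and dividing by \<open>N\<close> separates the two errors.\<close>

lemma zrank_estimate:
  assumes "N > 0"
    and S: "S = (\<Sum>z\<in>roots. of_nat (order z P) * z ^ N)"
  shows "\<bar>real (zrank (lie_comp X d N)) - real g / real N * \<phi> ^ N\<bar>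
    \<le> cmod (S - of_real (real g * \<phi> ^ N)) / real N + real g * \<phi> powr (real N / 2)"
proof -
  obtain ds where ds: "\<forall>e\<in>set ds. e \<ge> 1"
    "fps_X ^ Suc N dvd (\<Prod>e\<leftarrow>ds. 1 - fps_X ^ e) - (1 - (\<Sum>x\<in>X. fps_X ^ d x) :: complex fps)"
    "card (exponents ds N) = card (words X d N)"
    "zrank (lie_comp X d N) = card {i. i < length ds \<and> ds ! i = N}"
    by (rule zrank_lie_comp[OF finX dpos])
  define r where "r = zrank (lie_comp X d N)"
  define T where "T = (\<Sum>e\<leftarrow>ds. if e dvd N \<and> e \<noteq> N then e else 0)"
  define c where "c = real g * \<phi> ^ N"
  have "(\<Sum>e\<leftarrow>ds. if e = N then N else 0) = (\<Sum>i<length ds. if ds ! i = N then N else 0)"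
    by (simp only: sum_list_sum_nth length_map atLeast0LessThan) simp
  also have "\<dots> = N * r"
    unfolding r_def ds(4) by (simp add: sum.If_cases lessThan_def Collect_conj_eq[symmetric])
  finally have "(\<Sum>e\<leftarrow>ds. if e = N then N else 0) = N * r" .
  moreover have "(\<Sum>e\<leftarrow>ds. if e dvd N then e else 0) = (\<Sum>e\<leftarrow>ds. if e = N then N else 0) + T"
    unfolding T_def by (induction ds) auto
  ultimately have "(\<Sum>e\<leftarrow>ds. if e dvd N then e else 0) = N * r + T" by (simp only:)
  with divisor_sum_eq_power_sum[OF ds(1,2) \<open>N > 0\<close>] have S': "S = of_nat (N * r + T)"
    by (simp only: S)
  have "(real T / real N)\<^sup>2 \<le> real (card (words X d N))"
    unfolding T_def ds(3)[symmetric] by (rule proper_divisor_sum_le[OF ds(1) \<open>N > 0\<close>])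
  also have "\<dots> \<le> \<phi> ^ N" by (rule card_words_le)
  also have "\<dots> = (\<phi> powr (real N / 2))\<^sup>2"
    using phi_pos by (simp add: powr_power powr_realpow)
  finally have "real T / real N \<le> \<phi> powr (real N / 2)"
    by (rule power2_le_imp_le) simp
  also have "\<dots> \<le> real g * \<phi> powr (real N / 2)"
    using mult_right_mono[of 1 "real g" "\<phi> powr (real N / 2)"] g_pos by (simp add: Suc_le_eq)
  finally have T: "real T / real N \<le> real g * \<phi> powr (real N / 2)" .
  have "S - of_real c = of_real (real (N * r + T) - c)"
    unfolding S' by simp
  then have E: "cmod (S - of_real c) = \<bar>real (N * r + T) - c\<bar>"
    by (simp only: norm_of_real)
  have "real r - c / real N = (real (N * r + T) - c) / real N - real T / real N"
    using \<open>N > 0\<close> by (simp add: field_simps)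
  also have "\<bar>\<dots>\<bar> \<le> \<bar>(real (N * r + T) - c) / real N\<bar> + \<bar>real T / real N\<bar>"
    by (rule abs_triangle_ineq4)
  also have "\<dots> = cmod (S - of_real c) / real N + real T / real N"
    unfolding E by (simp add: abs_divide)
  finally have "\<bar>real r - c / real N\<bar> \<le> cmod (S - of_real c) / real N + real T / real N" .
  then show ?thesis using T unfolding r_def c_def by simp
qed

lemma zrank_estimate_subdominant:
  assumes "N > 0" "g dvd N" and psi: "\<forall>z\<in>roots. cmod z < \<phi> \<longrightarrow> cmod z \<le> r" and "r \<ge> 0"
  shows "\<bar>real (zrank (lie_comp X d N)) - real g / real N * \<phi> ^ N\<bar>
    \<le> real m / real N * r ^ N + real g * \<phi> powr (real N / 2)"
proof -
  have "cmod ((\<Sum>z\<in>roots. of_nat (order z P) * z ^ N) - of_real (real g * \<phi> ^ N)) / real N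
      \<le> real m * r ^ N / real N"
    by (intro divide_right_mono power_sum_estimate(1) assms) simp
  then show ?thesis using zrank_estimate[OF \<open>N > 0\<close> refl] by simp
qed

lemma zrank_estimate_no_subdominant:
  assumes "N > 0" "g dvd N" "\<forall>z\<in>roots. cmod z \<ge> \<phi>"
  shows "\<bar>real (zrank (lie_comp X d N)) - real g / real N * \<phi> ^ N\<bar> \<le> real g * \<phi> powr (real N / 2)"
proof -
  have "(\<Sum>z\<in>roots. of_nat (order z P) * z ^ N) = of_real (real g * \<phi> ^ N)"
    \<comment> \<open>With no roots inside the circle the bound by \<open>r\<close> is vacuous, so 0
      serves.\<close>
    by (rule power_sum_estimate(2)[where r = 0]) (use assms in force)+
  then show ?thesis using zrank_estimate[OF \<open>N > 0\<close> refl] by simp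
qed

end

theorem mainTheorem13:
  fixes X :: "'a set" and d :: "'a \<Rightarrow> nat" and \<phi> :: real
  assumes "finite X" and "X \<noteq> {}" and "\<forall>x\<in>X. d x \<ge> 1"
    and "\<phi> > 0" and "poly (charP X d) (complex_of_real \<phi>) = 0"
  shows "(\<forall>N::nat. N > 0 \<longrightarrow> \<not> Gcd (d ` X) dvd N \<longrightarrow> zrank (lie_comp X d N) = 0)
    \<and> (\<forall>\<psi>::complex. poly (charP X d) \<psi> = 0 \<and> cmod \<psi> < \<phi>
          \<and> (\<forall>z. poly (charP X d) z = 0 \<and> cmod z < \<phi> \<longrightarrow> cmod z \<le> cmod \<psi>) \<longrightarrow>
        (\<forall>N::nat. N > 0 \<longrightarrow> Gcd (d ` X) dvd N \<longrightarrow>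
           \<bar>real (zrank (lie_comp X d N)) - real (Gcd (d ` X)) / real N * \<phi> ^ N\<bar>
             \<le> real (Max (d ` X)) / real N * cmod \<psi> ^ N
               + real (Gcd (d ` X)) * \<phi> powr (real N / 2)
               + real (Max (d ` X)) * cmod \<psi> powr (real N / 2)))
    \<and> ((\<forall>z. poly (charP X d) z = 0 \<longrightarrow> cmod z \<ge> \<phi>) \<longrightarrow>
        (\<forall>N::nat. N > 0 \<longrightarrow> Gcd (d ` X) dvd N \<longrightarrow>
           \<bar>real (zrank (lie_comp X d N)) - real (Gcd (d ` X)) / real N * \<phi> ^ N\<bar>
             \<le> real (Gcd (d ` X)) * \<phi> powr (real N / 2)))
    \<and> \<phi> \<ge> real (\<Sum>q\<in>d ` X. mult_deg X d q) powr (1 / real (Max (d ` X)))"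
proof -
  interpret free_lie_degrees X d \<phi>
    using assms by unfold_locales
  have sub: "\<bar>real (zrank (lie_comp X d N)) - real g / real N * \<phi> ^ N\<bar>
      \<le> real m / real N * cmod \<psi> ^ N + real g * \<phi> powr (real N / 2)
        + real m * cmod \<psi> powr (real N / 2)"
    if "\<forall>z. poly P z = 0 \<and> cmod z < \<phi> \<longrightarrow> cmod z \<le> cmod \<psi>" "N > 0" "g dvd N" for \<psi> N
  proof -
    have "\<forall>z\<in>roots. cmod z < \<phi> \<longrightarrow> cmod z \<le> cmod \<psi>" using that(1) by simp
    from zrank_estimate_subdominant[OF that(2,3) this norm_ge_zero]
    have "\<bar>real (zrank (lie_comp X d N)) - real g / real N * \<phi> ^ N\<bar>
      \<le> real m / real N * cmod \<psi> ^ N + real g * \<phi> powr (real N / 2)" .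
    moreover have "0 \<le> real m * cmod \<psi> powr (real N / 2)" by simp
    ultimately show ?thesis by linarith
  qed
  have no_sub: "\<bar>real (zrank (lie_comp X d N)) - real g / real N * \<phi> ^ N\<bar>
      \<le> real g * \<phi> powr (real N / 2)"
    if "\<forall>z. poly P z = 0 \<longrightarrow> cmod z \<ge> \<phi>" "N > 0" "g dvd N" for N
  proof -
    have "\<forall>z\<in>roots. cmod z \<ge> \<phi>" using that(1) by simp
    from zrank_estimate_no_subdominant[OF that(2,3) this] show ?thesis .
  qed
  show ?thesis
  proof (intro conjI allI impI)
    show "zrank (lie_comp X d N) = 0" if "\<not> g dvd N" for N
      by (rule zrank_eq_0[OF that])
  qed (use sub no_sub phi_lower_bound in simp_all)
qed

end
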